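(* Let $L$ be an even unimodular lattice, let $g,h\in\mathrm{Aut}(L)$ commute, with commuting standard lifts $\hat g,\hat h\in\mathrm{Aut}(V_L)$, let $W_{\hat g}$ be the irreducible $\hat g$-twisted $V_L$-module and $\phi_{\hat g}(\hat h)$ the action of $\hat h$ on $W_{\hat g}$. The lattice contribution to the twining character, i.e. the graded trace $T_L(\hat g,\hat h,\tau)$ of $\phi_{\hat g}(\hat h)$ on the vacuum space $\Omega=\bigoplus_{\alpha\in\Lambda}U_\alpha\Omega_0$, where $U_\alpha\Omega_0$ is given degree $|\pi_g(\alpha)|^2/2$, is $$T_L(\hat g,\hat h,\tau)=\sum_{\alpha\in\Lambda_h}q^{\frac{|\pi_g(\alpha)|^2}{2}}\,\eta_h(\alpha)^{-1}\,\epsilon(\alpha,\alpha(h-1))\,B(\alpha,\alpha(h-1))\ \mathrm{Tr}\big|_{\Omega_0}\big(U_{\alpha(h-1)}\phi_{\hat g}(\hat h)\big),$$ where $\Lambda_h=\{\alpha\in\Lambda:\pi_g(\alpha)=\pi_g(\alpha h)\}$ and $q=e^{2\pi i\tau}$.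
   Context: Lattice automorphisms act on the right; $n$ is the order of $g$; $\xi_n$ a primitive $n$-th root of unity; $\pi_g$ the orthogonal projection of $\mathfrak h=L\otimes\mathbb C$ onto its $g$-invariant subspace; $L_g^\perp=L\cap\ker\pi_g$; $\Lambda\subset L$ a fixed sublattice with $L=\Lambda\oplus L_g^\perp$. $\epsilon:L\times L\to\{\pm1\}$ is bimultiplicative with $\epsilon(\alpha,\alpha)=(-1)^{|\alpha|^2/2}$, and $\mathfrak e_\alpha\mathfrak e_\beta=\epsilon(\alpha,\beta)\mathfrak e_{\alpha+\beta}$. A lift of $g$ acts by $\hat g\mathfrak e_\alpha=\eta_g(\alpha)^{-1}\mathfrak e_{\alpha g}$, where $\eta_g:L\to\mathbb C^*$ satisfies $\eta_g(\alpha)\eta_g(\beta)\epsilon(\alpha,\beta)=\eta_g(\alpha+\beta)\epsilon(\alpha g,\beta g)$; it is standard if $\eta_g=1$ on the $g$-fixed sublattice. $B(\alpha,\beta)=n^{-\langle\alpha|\beta\rangle}\prod_{k=1}^{n-1}(1-\xi_n^k)^{\langle\alpha g^k|\beta\rangle}$. The $g$-twisted Heisenberg algebra $\hat{\mathfrak h}_g$ is spanned by $v_m$ with $v\in\mathfrak h$, $vg=\xi_n^{-j}v$, $m\in\frac jn+\mathbb Z$ (and a central element). The twisted module $W_{\hat g}$ is the tensor product of the Fock space generated by the creation operators $v_{-m}$ ($m>0$) with the vacuum space $\Omega=\{w:v_mw=0\ \forall m>0\}$. On $\Omega$ act invertible operators $U_\alpha$ ($\alpha\in L$) with $U_\alpha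 U_\beta=\epsilon(\alpha,\beta)B(\alpha,\beta)^{-1}U_{\alpha+\beta}$, and $\Omega=\bigoplus_{\alpha\in\pi_g(L)}\Omega_\alpha$ with $\Omega_\alpha$ the eigenspace of the zero modes of weight $\alpha$, $U_\beta\Omega_\alpha=\Omega_{\alpha+\pi_g(\beta)}$. $\Omega_0$ is finite-dimensional, is preserved by $U_\mu$ for $\mu\in L_g^\perp$, and $\Omega=\bigoplus_{\alpha\in\Lambda}U_\alpha\Omega_0$. The map $\phi_{\hat g}(\hat h):W_{\hat g}\to W_{\hat g}$ is the (unique up to scalar) linear map with $\phi_{\hat g}(\hat h)Y_W(v,x)\phi_{\hat g}(\hat h)^{-1}=Y_W(\hat hv,x)$; it preserves $\Omega_0$ and satisfies $\phi_{\hat g}(\hat h)\,v^1_{-n_1}\cdots v^k_{-n_k}U_\alpha w=(v^1h)_{-n_1}\cdots(v^kh)_{-n_k}\,\eta_h(\alpha)^{-1}U_{\alpha h}\,\phi_{\hat g}(\hat h)w$ for $w\in\Omega_0$. *)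

theory Defs
  imports "HOL-Analysis.Analysis" "HOL-Library.Groups_Big_Fun"
begin

(* Lattices are positive definite and of full rank in real ^ 'n; the space L \<otimes> C is
   complex ^ 'n.  The right action \<alpha> g of an automorphism g is written  g \<alpha>,  so \<alpha> g h is
   h (g \<alpha>). *)

section \<open>Even unimodular lattices and their automorphisms\<close>

definition full_lattice :: "(real ^ 'n) set \<Rightarrow> bool" where
  "full_lattice L \<longleftrightarrow>
     (\<exists>B. independent B \<and> span B = UNIV \<and>
          L = {(\<Sum>b\<in>B. of_int (c b) *\<^sub>R b) | c :: real ^ 'n \<Rightarrow> int. True})"

definition dual_lattice :: "(real ^ 'n) set \<Rightarrow> (real ^ 'n) set" where
  "dual_lattice L = {x. \<forall>\<alpha>\<in>L. x \<bullet> \<alpha> \<in> \<int>}"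

definition even_unimodular_lattice :: "(real ^ 'n) set \<Rightarrow> bool" where
  "even_unimodular_lattice L \<longleftrightarrow>
     full_lattice L \<and> (\<forall>\<alpha>\<in>L. \<exists>k::int. \<alpha> \<bullet> \<alpha> = 2 * of_int k) \<and> dual_lattice L = L"

definition lattice_Aut :: "(real ^ 'n) set \<Rightarrow> (real ^ 'n \<Rightarrow> real ^ 'n) set" where
  "lattice_Aut L = {g. orthogonal_transformation g \<and> g ` L = L}"

(* On a lattice with integral inner products the floor is exact; it only turns the inner product
   into an integer exponent or mode index. *)
definition ip :: "real ^ 'n \<Rightarrow> real ^ 'n \<Rightarrow> int" where
  "ip \<alpha> \<beta> = \<lfloor>\<alpha> \<bullet> \<beta>\<rfloor>"

definition fun_order :: "('a \<Rightarrow> 'a) \<Rightarrow> nat" where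
  "fun_order f = (LEAST n. 0 < n \<and> f ^^ n = id)"

definition primitive_root_of_unity :: "nat \<Rightarrow> complex \<Rightarrow> bool" where
  "primitive_root_of_unity n z \<longleftrightarrow> 0 < n \<and> z ^ n = 1 \<and> (\<forall>k. 0 < k \<and> k < n \<longrightarrow> z ^ k \<noteq> 1)"

definition cvec :: "real ^ 'n \<Rightarrow> complex ^ 'n" where
  "cvec x = (\<chi> i. of_real (x $ i))"

definition cform :: "complex ^ 'n \<Rightarrow> complex ^ 'n \<Rightarrow> complex" where
  "cform u v = (\<Sum>i\<in>UNIV. u $ i * v $ i)"

(* C-linear extension of a real-linear map *)
definition cmap :: "(real ^ 'n \<Rightarrow> real ^ 'n) \<Rightarrow> complex ^ 'n \<Rightarrow> complex ^ 'n" where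
  "cmap g v = cvec (g (\<chi> i. Re (v $ i))) + \<i> *s cvec (g (\<chi> i. Im (v $ i)))"

(* The orthogonal projection \<pi>_g of complex ^ 'n onto the g-invariants is the C-linear extension
   of this real projection; it is only ever applied to real vectors. *)
definition fix_proj :: "(real ^ 'n \<Rightarrow> real ^ 'n) \<Rightarrow> real ^ 'n \<Rightarrow> real ^ 'n" where
  "fix_proj g x = (THE p. g p = p \<and> (\<forall>u. g u = u \<longrightarrow> (x - p) \<bullet> u = 0))"

definition fixed_perp :: "(real ^ 'n) set \<Rightarrow> (real ^ 'n \<Rightarrow> real ^ 'n) \<Rightarrow> (real ^ 'n) set" where
  "fixed_perp L g = {\<alpha>\<in>L. fix_proj g \<alpha> = 0}"

definition complement_sublattice ::
    "(real ^ 'n) set \<Rightarrow> (real ^ 'n \<Rightarrow> real ^ 'n) \<Rightarrow> (real ^ 'n) set \<Rightarrow> bool" where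
  "complement_sublattice L g \<Lambda> \<longleftrightarrow>
     \<Lambda> \<subseteq> L \<and> 0 \<in> \<Lambda> \<and> (\<forall>x\<in>\<Lambda>. \<forall>y\<in>\<Lambda>. x - y \<in> \<Lambda>) \<and>
     L = {x + y | x y. x \<in> \<Lambda> \<and> y \<in> fixed_perp L g} \<and> \<Lambda> \<inter> fixed_perp L g = {0}"

definition lattice_cocycle :: "(real ^ 'n) set \<Rightarrow> (real ^ 'n \<Rightarrow> real ^ 'n \<Rightarrow> complex) \<Rightarrow> bool" where
  "lattice_cocycle L \<epsilon> \<longleftrightarrow>
     (\<forall>\<alpha>\<in>L. \<forall>\<beta>\<in>L. \<epsilon> \<alpha> \<beta> \<in> {1, -1}) \<and>
     (\<forall>\<alpha>\<in>L. \<forall>\<beta>\<in>L. \<forall>\<gamma>\<in>L. \<epsilon> (\<alpha> + \<beta>) \<gamma> = \<epsilon> \<alpha> \<gamma> * \<epsilon> \<beta> \<gamma> \<and> \<epsilon> \<alpha> (\<beta> + \<gamma>) = \<epsilon> \<alpha> \<beta> * \<epsilon> \<alpha> \<gamma>) \<and>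
     (\<forall>\<alpha>\<in>L. \<epsilon> \<alpha> \<alpha> = (-1) powi (ip \<alpha> \<alpha> div 2))"

definition bfactor ::
    "complex \<Rightarrow> (real ^ 'n \<Rightarrow> real ^ 'n) \<Rightarrow> real ^ 'n \<Rightarrow> real ^ 'n \<Rightarrow> complex" where
  "bfactor \<xi> g \<alpha> \<beta> =
     of_nat (fun_order g) powi (- ip \<alpha> \<beta>) *
     (\<Prod>k = 1..<fun_order g. (1 - \<xi> ^ k) powi (ip ((g ^^ k) \<alpha>) \<beta>))"

section \<open>Vertex algebras and the lattice vertex algebra\<close>

(* mode a m b is the m-th product a_(m) b, where Y(a,x) = sum over m of a_(m) x^(-m-1).  All sums
   in the Borcherds identity are finite by truncation, as Sum_any requires. *)
locale vertex_algebra =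
  fixes sc :: "complex \<Rightarrow> 'v \<Rightarrow> 'v::ab_group_add"
    and vac :: 'v
    and mode :: "'v \<Rightarrow> int \<Rightarrow> 'v \<Rightarrow> 'v"
  assumes vector_space: "vector_space sc"
    and linear_right: "Vector_Spaces.linear sc sc (mode a m)"
    and linear_left: "Vector_Spaces.linear sc sc (\<lambda>a. mode a m b)"
    and truncation: "\<exists>M. \<forall>m\<ge>M. mode a m b = 0"
    and vacuum: "mode vac m a = (if m = -1 then a else 0)"
    and creation: "mode a (-1) vac = a" "0 \<le> m \<Longrightarrow> mode a m vac = 0"
    and borcherds:
      "Sum_any (\<lambda>s. sc (of_int m gchoose s) (mode (mode a (l + int s) b) (m + k - int s) c)) =
       Sum_any (\<lambda>s. sc ((-1) ^ s * (of_int l gchoose s))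
                       (mode a (m + l - int s) (mode b (k + int s) c))) -
       Sum_any (\<lambda>s. sc ((-1) ^ s * (of_int l gchoose s) * (-1) powi l)
                       (mode b (k + l - int s) (mode a (m + int s) c)))"

definition va_automorphism ::
    "(complex \<Rightarrow> 'v \<Rightarrow> 'v::ab_group_add) \<Rightarrow> 'v \<Rightarrow> ('v \<Rightarrow> int \<Rightarrow> 'v \<Rightarrow> 'v) \<Rightarrow> ('v \<Rightarrow> 'v) \<Rightarrow> bool" where
  "va_automorphism sc vac mode f \<longleftrightarrow>
     Vector_Spaces.linear sc sc f \<and> bij f \<and> f vac = vac \<and>
     (\<forall>a m b. f (mode a m b) = mode (f a) m (f b))"

inductive_set fock_monomials ::
    "('v \<Rightarrow> int \<Rightarrow> 'v \<Rightarrow> 'v) \<Rightarrow> (real ^ 'n) set \<Rightarrow> (complex ^ 'n \<Rightarrow> 'v) \<Rightarrow> (real ^ 'n \<Rightarrow> 'v) \<Rightarrow> 'v set"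
  for mode L cur ex where
  base: "\<alpha> \<in> L \<Longrightarrow> ex \<alpha> \<in> fock_monomials mode L cur ex"
| step: "x \<in> fock_monomials mode L cur ex \<Longrightarrow> m < 0 \<Longrightarrow>
         mode (cur v) m x \<in> fock_monomials mode L cur ex"

(* V_L = S(h t^-1 [t^-1]) \<otimes> C_\<epsilon>[L], where  cur v = v_(-1) vac  and  ex \<alpha> = 1 \<otimes> e_\<alpha>.  The
   leading terms of the operator product expansions of the generating fields determine V_L up to
   isomorphism:
     u(x) v(y) ~ <u|v> (x-y)^-2,   v(x) e_\<alpha>(y) ~ <v|\<alpha>> (x-y)^-1 e_\<alpha>(y),
     e_\<alpha>(x) e_\<beta>(y) = \<epsilon>(\<alpha>,\<beta>) (x-y)^<\<alpha>|\<beta>> (e_(\<alpha>+\<beta>)(y) + ...).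
   Linear independence of the Fock monomials (in a basis of h) follows. *)
locale lattice_vertex_algebra = vertex_algebra sc vac mode
  for sc :: "complex \<Rightarrow> 'v \<Rightarrow> 'v::ab_group_add" and vac mode +
  fixes L :: "(real ^ 'n) set"
    and \<epsilon> :: "real ^ 'n \<Rightarrow> real ^ 'n \<Rightarrow> complex"
    and cur :: "complex ^ 'n \<Rightarrow> 'v"
    and ex :: "real ^ 'n \<Rightarrow> 'v"
  assumes nontrivial: "vac \<noteq> 0"
    and cur_linear: "Vector_Spaces.linear (*s) sc cur"
    and cur_cur: "0 \<le> m \<Longrightarrow> mode (cur u) m (cur v) = (if m = 1 then sc (cform u v) vac else 0)"
    and cur_ex: "\<alpha> \<in> L \<Longrightarrow> 0 \<le> m \<Longrightarrow>
          mode (cur v) m (ex \<alpha>) = (if m = 0 then sc (cform v (cvec \<alpha>)) (ex \<alpha>) else 0)"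
    and ex_zero: "ex 0 = vac"
    and ex_ex_regular: "\<alpha> \<in> L \<Longrightarrow> \<beta> \<in> L \<Longrightarrow> - ip \<alpha> \<beta> \<le> m \<Longrightarrow> mode (ex \<alpha>) m (ex \<beta>) = 0"
    and ex_ex_leading: "\<alpha> \<in> L \<Longrightarrow> \<beta> \<in> L \<Longrightarrow>
          mode (ex \<alpha>) (- ip \<alpha> \<beta> - 1) (ex \<beta>) = sc (\<epsilon> \<alpha> \<beta>) (ex (\<alpha> + \<beta>))"
    and ex_derivative: "\<alpha> \<in> L \<Longrightarrow> mode (ex \<alpha>) (-2) vac = mode (cur (cvec \<alpha>)) (-1) (ex \<alpha>)"
    and spanning: "module.span sc (fock_monomials mode L cur ex) = UNIV"

definition conformal_vector ::
    "(complex \<Rightarrow> 'v \<Rightarrow> 'v::ab_group_add) \<Rightarrow> ('v \<Rightarrow> int \<Rightarrow> 'v \<Rightarrow> 'v) \<Rightarrow> (complex ^ 'n \<Rightarrow> 'v) \<Rightarrow> 'v" where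
  "conformal_vector sc mode cur =
     sc (1/2) (\<Sum>i\<in>UNIV. mode (cur (axis i 1)) (-1) (cur (axis i 1)))"

definition standard_lift ::
    "(complex \<Rightarrow> 'v \<Rightarrow> 'v::ab_group_add) \<Rightarrow> 'v \<Rightarrow> ('v \<Rightarrow> int \<Rightarrow> 'v \<Rightarrow> 'v) \<Rightarrow>
     (real ^ 'n) set \<Rightarrow> (real ^ 'n \<Rightarrow> real ^ 'n \<Rightarrow> complex) \<Rightarrow>
     (complex ^ 'n \<Rightarrow> 'v) \<Rightarrow> (real ^ 'n \<Rightarrow> 'v) \<Rightarrow>
     (real ^ 'n \<Rightarrow> real ^ 'n) \<Rightarrow> (real ^ 'n \<Rightarrow> complex) \<Rightarrow> ('v \<Rightarrow> 'v) \<Rightarrow> bool" where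
  "standard_lift sc vac mode L \<epsilon> cur ex g \<eta> ghat \<longleftrightarrow>
     (\<forall>\<alpha>\<in>L. \<eta> \<alpha> \<noteq> 0) \<and>
     (\<forall>\<alpha>\<in>L. \<forall>\<beta>\<in>L. \<eta> \<alpha> * \<eta> \<beta> * \<epsilon> \<alpha> \<beta> = \<eta> (\<alpha> + \<beta>) * \<epsilon> (g \<alpha>) (g \<beta>)) \<and>
     (\<forall>\<alpha>\<in>L. g \<alpha> = \<alpha> \<longrightarrow> \<eta> \<alpha> = 1) \<and>
     va_automorphism sc vac mode ghat \<and>
     (\<forall>v. ghat (cur v) = cur (cmap g v)) \<and>
     (\<forall>\<alpha>\<in>L. ghat (ex \<alpha>) = sc (inverse (\<eta> \<alpha>)) (ex (g \<alpha>)))"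

section \<open>Twisted modules\<close>

(* ghat has order N (which is n or 2n for a standard lift of g of order n), \<zeta> is a primitive N-th
   root of unity, and a vector a with ghat a = \<zeta>^-j a has modes indexed by j/N + Z.
   Y a m w is a_(m) w, where Y_W(a,x) = sum over m of a_(m) x^(-m-1).  The conformal vector
   is \<omega>. *)
locale twisted_module = vertex_algebra sc vac mode
  for sc :: "complex \<Rightarrow> 'v \<Rightarrow> 'v::ab_group_add" and vac mode +
  fixes \<omega> :: 'v
    and ghat :: "'v \<Rightarrow> 'v"
    and \<zeta> :: complex
    and scW :: "complex \<Rightarrow> 'w \<Rightarrow> 'w::ab_group_add"
    and Y :: "'v \<Rightarrow> real \<Rightarrow> 'w \<Rightarrow> 'w"
  assumes W_vector_space: "vector_space scW"
    and W_linear_right: "Vector_Spaces.linear scW scW (Y a r)"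
    and W_linear_left: "Vector_Spaces.linear sc scW (\<lambda>a. Y a r w)"
    and W_truncation: "\<exists>M. \<forall>r\<ge>M. Y a r w = 0"
    and W_vacuum: "Y vac r w = (if r = -1 then w else 0)"
    and W_modes: "ghat a = sc (\<zeta> powi (-j)) a \<Longrightarrow>
          r - of_int j / real (fun_order ghat) \<notin> \<int> \<Longrightarrow> Y a r w = 0"
    and W_borcherds:
      "ghat a = sc (\<zeta> powi (-i)) a \<Longrightarrow> r - of_int i / real (fun_order ghat) \<in> \<int> \<Longrightarrow>
       ghat b = sc (\<zeta> powi (-j)) b \<Longrightarrow> t - of_int j / real (fun_order ghat) \<in> \<int> \<Longrightarrow>
       Sum_any (\<lambda>s. scW (of_real r gchoose s) (Y (mode a (l + int s) b) (r + t - real s) w)) =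
       Sum_any (\<lambda>s. scW ((-1) ^ s * (of_int l gchoose s))
                        (Y a (r + of_int l - real s) (Y b (t + real s) w))) -
       Sum_any (\<lambda>s. scW ((-1) ^ s * (of_int l gchoose s) * (-1) powi l)
                        (Y b (t + of_int l - real s) (Y a (r + real s) w)))"
    and W_graded: "module.span scW {w. \<exists>c. Y \<omega> 1 w = scW c w} = UNIV"
    and W_finite: "\<exists>F. finite F \<and> module.span scW F = {w. Y \<omega> 1 w = scW c w}"
    and W_bounded: "\<exists>K::nat. \<forall>k\<ge>K.
          {w. Y \<omega> 1 w = scW (c - of_nat k / of_nat (fun_order ghat)) w} = {0}"

locale irreducible_twisted_module = twisted_module sc vac mode \<omega> ghat \<zeta> scW Y
  for sc :: "complex \<Rightarrow> 'v \<Rightarrow> 'v::ab_group_add" and vac mode \<omega> ghat \<zeta>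
    and scW :: "complex \<Rightarrow> 'w \<Rightarrow> 'w::ab_group_add" and Y +
  assumes W_nonzero: "\<exists>w::'w. w \<noteq> 0"
    and W_irreducible: "module.subspace scW S \<Longrightarrow> (\<And>a r w. w \<in> S \<Longrightarrow> Y a r w \<in> S) \<Longrightarrow>
          S = {0} \<or> S = UNIV"

(* the action of hhat on W, unique up to a scalar when W is irreducible *)
definition intertwines ::
    "(complex \<Rightarrow> 'w \<Rightarrow> 'w::ab_group_add) \<Rightarrow> ('v \<Rightarrow> real \<Rightarrow> 'w \<Rightarrow> 'w) \<Rightarrow>
     ('v \<Rightarrow> 'v) \<Rightarrow> ('w \<Rightarrow> 'w) \<Rightarrow> bool" where
  "intertwines scW Y hhat \<phi> \<longleftrightarrow>
     Vector_Spaces.linear scW scW \<phi> \<and> bij \<phi> \<and> (\<forall>a r w. \<phi> (Y a r w) = Y (hhat a) r (\<phi> w))"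

section \<open>The vacuum space\<close>

(* For general v,  Y (cur v) m  is the mode of the component of v in the eigenspace of g that
   belongs to m, so v need not be restricted to eigenvectors. *)
definition vacuum_space ::
    "(complex ^ 'n \<Rightarrow> 'v) \<Rightarrow> ('v \<Rightarrow> real \<Rightarrow> 'w \<Rightarrow> 'w::ab_group_add) \<Rightarrow> 'w set" where
  "vacuum_space cur Y = {w. \<forall>v. \<forall>m>0. Y (cur v) m w = 0}"

definition weight_space ::
    "(complex ^ 'n \<Rightarrow> 'v) \<Rightarrow> (complex \<Rightarrow> 'w \<Rightarrow> 'w::ab_group_add) \<Rightarrow> ('v \<Rightarrow> real \<Rightarrow> 'w \<Rightarrow> 'w) \<Rightarrow>
     (real ^ 'n \<Rightarrow> real ^ 'n) \<Rightarrow> real ^ 'n \<Rightarrow> 'w set" where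
  "weight_space cur scW Y g \<beta> =
     {w \<in> vacuum_space cur Y.
        \<forall>v. cmap g v = v \<longrightarrow> Y (cur v) 0 w = scW (cform v (cvec \<beta>)) w}"

(* The standard structure of the vacuum space \<Omega> of the irreducible twisted V_L-module.  The operator
   U_\<alpha> is the constant term in
     Y_W(e_\<alpha>,x) = E^-(\<alpha>,x) E^+(\<alpha>,x) U_\<alpha> x^(b_\<alpha>) x^(\<pi>_g(\<alpha>)_0),
     b_\<alpha> = (|\<pi>_g(\<alpha>)|^2 - |\<alpha>|^2)/2,   E^+ = 1 on \<Omega>,   E^- = 1 + higher powers of x,
   so on the weight space \<Omega>_\<beta> it is the coefficient of x^(b_\<alpha> + <\<alpha>|\<beta>>) in Y_W(e_\<alpha>,x).
   Weight spaces for different weights in \<pi>_g(L) are independent, so the sum is direct. *)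
locale vacuum_operators =
  fixes L :: "(real ^ 'n) set"
    and \<epsilon> :: "real ^ 'n \<Rightarrow> real ^ 'n \<Rightarrow> complex"
    and g :: "real ^ 'n \<Rightarrow> real ^ 'n"
    and \<xi> :: complex
    and cur :: "complex ^ 'n \<Rightarrow> 'v"
    and ex :: "real ^ 'n \<Rightarrow> 'v"
    and scW :: "complex \<Rightarrow> 'w \<Rightarrow> 'w::ab_group_add"
    and Y :: "'v \<Rightarrow> real \<Rightarrow> 'w \<Rightarrow> 'w"
    and U :: "real ^ 'n \<Rightarrow> 'w \<Rightarrow> 'w"
  assumes U_leading: "\<alpha> \<in> L \<Longrightarrow> \<beta> \<in> fix_proj g ` L \<Longrightarrow> w \<in> weight_space cur scW Y g \<beta> \<Longrightarrow>
          U \<alpha> w = Y (ex \<alpha>) (- 1 - (fix_proj g \<alpha> \<bullet> fix_proj g \<alpha> - \<alpha> \<bullet> \<alpha>) / 2 - \<alpha> \<bullet> \<beta>) w"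
    and U_add: "\<alpha> \<in> L \<Longrightarrow> w \<in> vacuum_space cur Y \<Longrightarrow> w' \<in> vacuum_space cur Y \<Longrightarrow>
          U \<alpha> (w + w') = U \<alpha> w + U \<alpha> w'"
    and U_scale: "\<alpha> \<in> L \<Longrightarrow> w \<in> vacuum_space cur Y \<Longrightarrow> U \<alpha> (scW c w) = scW c (U \<alpha> w)"
    and U_bij: "\<alpha> \<in> L \<Longrightarrow> bij_betw (U \<alpha>) (vacuum_space cur Y) (vacuum_space cur Y)"
    and U_mult: "\<alpha> \<in> L \<Longrightarrow> \<beta> \<in> L \<Longrightarrow> w \<in> vacuum_space cur Y \<Longrightarrow>
          U \<alpha> (U \<beta> w) = scW (\<epsilon> \<alpha> \<beta> * inverse (bfactor \<xi> g \<alpha> \<beta>)) (U (\<alpha> + \<beta>) w)"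
    and weight_decomposition:
          "vacuum_space cur Y = module.span scW (\<Union>\<beta>\<in>fix_proj g ` L. weight_space cur scW Y g \<beta>)"
    and U_weight: "\<alpha> \<in> fix_proj g ` L \<Longrightarrow> \<beta> \<in> L \<Longrightarrow>
          U \<beta> ` weight_space cur scW Y g \<alpha> = weight_space cur scW Y g (\<alpha> + fix_proj g \<beta>)"
    and weight_zero_finite: "\<exists>F. finite F \<and> module.span scW F = weight_space cur scW Y g 0"

section \<open>The graded trace\<close>

(* trace of f on a finite-dimensional subspace S with f ` S \<subseteq> S, in a basis of S *)
definition trace_on ::
    "(complex \<Rightarrow> 'w \<Rightarrow> 'w::ab_group_add) \<Rightarrow> 'w set \<Rightarrow> ('w \<Rightarrow> 'w) \<Rightarrow> complex" where
  "trace_on scW S f =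
     (let B = (SOME B. \<not> module.dependent scW B \<and> module.span scW B = S)
      in \<Sum>b\<in>B. module.representation scW B (f b) b)"

definition vdegree :: "(real ^ 'n \<Rightarrow> real ^ 'n) \<Rightarrow> real ^ 'n \<Rightarrow> real" where
  "vdegree g \<alpha> = (norm (fix_proj g \<alpha>))\<^sup>2 / 2"

definition qpow :: "complex \<Rightarrow> real \<Rightarrow> complex" where
  "qpow \<tau> d = exp (2 * of_real pi * \<i> * \<tau> * of_real d)"

(* the degree d part of \<Omega>, the sum of the U_\<alpha> \<Omega>_0 with \<alpha> in \<Lambda> of degree d *)
definition vacuum_part ::
    "(complex ^ 'n \<Rightarrow> 'v) \<Rightarrow> (complex \<Rightarrow> 'w \<Rightarrow> 'w::ab_group_add) \<Rightarrow> ('v \<Rightarrow> real \<Rightarrow> 'w \<Rightarrow> 'w) \<Rightarrow>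
     (real ^ 'n \<Rightarrow> 'w \<Rightarrow> 'w) \<Rightarrow> (real ^ 'n) set \<Rightarrow> (real ^ 'n \<Rightarrow> real ^ 'n) \<Rightarrow> real \<Rightarrow> 'w set" where
  "vacuum_part cur scW Y U \<Lambda> g d =
     module.span scW (\<Union>\<alpha>\<in>{\<alpha>\<in>\<Lambda>. vdegree g \<alpha> = d}. U \<alpha> ` weight_space cur scW Y g 0)"

definition T_term ::
    "(complex ^ 'n \<Rightarrow> 'v) \<Rightarrow> (complex \<Rightarrow> 'w \<Rightarrow> 'w::ab_group_add) \<Rightarrow> ('v \<Rightarrow> real \<Rightarrow> 'w \<Rightarrow> 'w) \<Rightarrow>
     (real ^ 'n \<Rightarrow> 'w \<Rightarrow> 'w) \<Rightarrow> (real ^ 'n) set \<Rightarrow> (real ^ 'n \<Rightarrow> real ^ 'n) \<Rightarrow> ('w \<Rightarrow> 'w) \<Rightarrow>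
     complex \<Rightarrow> real \<Rightarrow> complex" where
  "T_term cur scW Y U \<Lambda> g \<phi> \<tau> d =
     qpow \<tau> d * trace_on scW (vacuum_part cur scW Y U \<Lambda> g d) \<phi>"

definition T_lattice ::
    "(complex ^ 'n \<Rightarrow> 'v) \<Rightarrow> (complex \<Rightarrow> 'w \<Rightarrow> 'w::ab_group_add) \<Rightarrow> ('v \<Rightarrow> real \<Rightarrow> 'w \<Rightarrow> 'w) \<Rightarrow>
     (real ^ 'n \<Rightarrow> 'w \<Rightarrow> 'w) \<Rightarrow> (real ^ 'n) set \<Rightarrow> (real ^ 'n \<Rightarrow> real ^ 'n) \<Rightarrow> ('w \<Rightarrow> 'w) \<Rightarrow>
     complex \<Rightarrow> complex" where
  "T_lattice cur scW Y U \<Lambda> g \<phi> \<tau> = (\<Sum>\<^sub>\<infinity>d\<in>vdegree g ` \<Lambda>. T_term cur scW Y U \<Lambda> g \<phi> \<tau> d)"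

end

theory Submission
  imports Defs
begin

text \<open>
  The map \<open>\<phi>\<close> sends the weight space \<open>\<Omega>\<^sub>\<beta>\<close> to \<open>\<Omega>\<close> at the weight \<open>h \<beta>\<close>, so on the finitely many weight
  spaces of a given degree it acts as a block permutation, and only the weights fixed by \<open>h\<close>, that is
  the \<open>\<pi>\<^sub>g(\<alpha>)\<close> with \<open>\<alpha> \<in> \<Lambda>\<^sub>h\<close>, contribute to the trace.  Conjugating by \<open>U\<^sub>\<alpha>\<close> and using
  \<open>U\<^sub>\<alpha> U\<^sub>\<gamma> = \<epsilon>(\<alpha>,\<gamma>) B(\<alpha>,\<gamma>)\<^sup>-\<^sup>1 U\<close> at \<open>\<alpha> + \<gamma>\<close> with \<open>\<gamma> = h \<alpha> - \<alpha>\<close> turns such a block into the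
  operator \<open>X\<^sub>\<alpha> \<phi>\<close> on \<open>\<Omega>\<^sub>0\<close>, where \<open>X\<^sub>\<alpha> = \<eta>(\<alpha>)\<^sup>-\<^sup>1 \<epsilon>(\<alpha>,\<gamma>) B(\<alpha>,\<gamma>) U\<^sub>\<gamma>\<close>.  For the convergence, \<open>X\<^sub>\<alpha>\<close> is
  multiplicative in \<open>\<alpha>\<close> up to a phase, so its operator norm is submultiplicative and grows at most like
  \<open>exp (c \<bar>\<pi>\<^sub>g(\<alpha>)\<bar>)\<close>; the factor \<open>\<bar>q\<bar>\<close> to the power \<open>\<bar>\<pi>\<^sub>g(\<alpha>)\<bar>\<^sup>2/2\<close> dominates this on the discrete group
  \<open>\<pi>\<^sub>g(L)\<close>.
\<close>

section \<open>Traces and operator norms on finite-dimensional subspaces\<close>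

locale complex_vector_space = vector_space sc
  for sc :: "complex \<Rightarrow> 'w \<Rightarrow> 'w::ab_group_add"
begin

definition lin_on :: "'w set \<Rightarrow> ('w \<Rightarrow> 'w) \<Rightarrow> bool" where
  "lin_on S f \<longleftrightarrow> (\<forall>x\<in>S. \<forall>y\<in>S. f (x + y) = f x + f y) \<and> (\<forall>c. \<forall>x\<in>S. f (sc c x) = sc c (f x))"

lemma lin_on_sum:
  assumes "subspace S" "lin_on S f" "finite I" "\<And>i. i \<in> I \<Longrightarrow> x i \<in> S"
  shows "f (\<Sum>i\<in>I. sc (u i) (x i)) = (\<Sum>i\<in>I. sc (u i) (f (x i)))"
  using assms(3,4)
proof (induction I rule: finite_induct)
  case empty
  have "f (sc 0 0) = sc 0 (f 0)"
    using assms(1,2) subspace_0 unfolding lin_on_def by blast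
  then show ?case by simp
next
  case (insert i I)
  have "(\<Sum>i\<in>I. sc (u i) (x i)) \<in> S"
    using insert by (intro subspace_sum subspace_scale assms(1)) auto
  moreover have "sc (u i) (x i) \<in> S"
    using insert by (intro subspace_scale assms(1)) auto
  ultimately show ?case
    using insert assms(2) by (simp add: lin_on_def)
qed

lemma representation_lincomb:
  assumes "independent D" "\<And>i. i \<in> I \<Longrightarrow> x i \<in> span D"
  shows "representation D (\<Sum>i\<in>I. sc (u i) (x i)) d = (\<Sum>i\<in>I. u i * representation D (x i) d)"
  using assms by (simp add: representation_sum representation_scale span_scale)

text \<open>\<open>trace_on\<close> refers to an arbitrarily chosen basis \<open>C\<close>, so this
  is independence of the trace from the basis: the matrices that pass between \<open>B\<close> and
  \<open>C\<close> are inverse to each other and cancel in the sum of the diagonal entries.\<close>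

lemma trace_on_basis:
  assumes B: "independent B" "finite B" "span B = S"
    and f: "lin_on S f" "f ` S \<subseteq> S"
  shows "trace_on sc S f = (\<Sum>b\<in>B. representation B (f b) b)"
proof -
  define C where "C = (SOME C. independent C \<and> span C = S)"
  have "independent C \<and> span C = S"
    unfolding C_def by (rule someI[where x = B]) (use B in auto)
  then have C: "independent C" "span C = S" by auto
  \<comment> \<open>The chosen basis is not given as finite; it is an independent set inside the
    span of the finite \<open>B\<close>.\<close>
  have finC: "finite C"
    using independent_span_bound[OF B(2) C(1)] B(3) C(2) span_superset by auto
  have sub: "subspace S" using B(3) by auto
  have BS: "B \<subseteq> S" and CS: "C \<subseteq> S" using B(3) C(2) span_superset by auto
  let ?RB = "representation B" and ?RC = "representation C"
  have exB: "(\<Sum>b\<in>B. sc (?RB v b) b) = v" if "v \<in> S" for v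
    using sum_representation_eq[of B v B] B that by auto
  have exC: "(\<Sum>c\<in>C. sc (?RC v c) c) = v" if "v \<in> S" for v
    using sum_representation_eq[of C v C] C finC that by auto
  have 1: "?RC (f c) c = (\<Sum>b\<in>B. \<Sum>b'\<in>B. ?RB c b * (?RB (f b) b' * ?RC b' c))" if "c \<in> C" for c
  proof -
    have "f c = f (\<Sum>b\<in>B. sc (?RB c b) b)"
      using exB that CS by auto
    also have "\<dots> = (\<Sum>b\<in>B. sc (?RB c b) (f b))"
      using BS by (intro lin_on_sum[OF sub f(1) B(2)]) auto
    finally have "?RC (f c) c = (\<Sum>b\<in>B. ?RB c b * ?RC (f b) c)"
      using BS f C by (simp add: representation_lincomb image_subset_iff subset_iff)
    moreover have "?RC (f b) c = (\<Sum>b'\<in>B. ?RB (f b) b' * ?RC b' c)" if "b \<in> B" for b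
    proof -
      have "?RC (f b) c = ?RC (\<Sum>b'\<in>B. sc (?RB (f b) b') b') c"
        using exB[of "f b"] that BS f(2) by (metis image_subset_iff subset_iff)
      then show ?thesis
        using BS C by (simp add: representation_lincomb subset_iff)
    qed
    ultimately show ?thesis by (simp add: sum_distrib_left)
  qed
  have 2: "(\<Sum>c\<in>C. ?RC b' c * ?RB c b) = (if b = b' then 1 else 0)" if "b' \<in> B" for b b'
  proof -
    have "(\<Sum>c\<in>C. ?RC b' c * ?RB c b) = ?RB (\<Sum>c\<in>C. sc (?RC b' c) c) b"
      using CS B by (subst representation_lincomb) auto
    also have "\<dots> = ?RB b' b" using exC that BS by auto
    finally show ?thesis using representation_basis[OF B(1) that] by simp
  qed
  have "trace_on sc S f = (\<Sum>c\<in>C. ?RC (f c) c)"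
    by (simp add: trace_on_def C_def Let_def)
  also have "\<dots> = (\<Sum>c\<in>C. \<Sum>b\<in>B. \<Sum>b'\<in>B. ?RB (f b) b' * (?RC b' c * ?RB c b))"
    using 1 by (simp add: mult_ac)
  also have "\<dots> = (\<Sum>b\<in>B. \<Sum>b'\<in>B. \<Sum>c\<in>C. ?RB (f b) b' * (?RC b' c * ?RB c b))"
    by (subst sum.swap, rule sum.cong[OF refl], rule sum.swap)
  also have "\<dots> = (\<Sum>b\<in>B. \<Sum>b'\<in>B. ?RB (f b) b' * (if b = b' then 1 else 0))"
    by (intro sum.cong refl) (simp add: 2 flip: sum_distrib_left)
  also have "\<dots> = (\<Sum>b\<in>B. ?RB (f b) b)"
    using B(2) by (intro sum.cong refl) (simp add: if_distrib sum.delta cong: if_cong)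
  finally show ?thesis .
qed

text \<open>The last claim, that coordinates are carried along, is what makes the matrices of
  conjugate maps agree.\<close>

lemma basis_image:
  assumes B: "independent B" "finite B" "span B = S"
    and A: "lin_on S A" "bij_betw A S S'"
  shows "independent (A ` B)" "span (A ` B) = S'" "inj_on A B"
    "\<And>v b. v \<in> S \<Longrightarrow> b \<in> B \<Longrightarrow> representation (A ` B) (A v) (A b) = representation B v b"
proof -
  have sub: "subspace S" using B(3) by auto
  have BS: "B \<subseteq> S" using B(3) span_superset by auto
  have injS: "inj_on A S" using A(2) by (rule bij_betw_imp_inj_on)
  show inj: "inj_on A B" using injS BS inj_on_subset by blast
  have A0: "A 0 = 0"
    using lin_on_sum[OF sub A(1), of "{}"] by simp
  have comb: "(\<Sum>w\<in>A ` B. sc (u w) w) = A (\<Sum>b\<in>B. sc (u (A b)) b)" for u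
    using lin_on_sum[OF sub A(1) B(2), of "\<lambda>b. b" "\<lambda>b. u (A b)"] BS
    by (simp add: sum.reindex[OF inj] subset_iff)
  have combS: "(\<Sum>b\<in>B. sc (u b) b) \<in> S" for u
    using BS by (intro subspace_sum subspace_scale sub) auto
  show ind: "independent (A ` B)"
    unfolding dependent_finite[OF finite_imageI[OF B(2)]]
  proof clarify
    fix u b assume s: "(\<Sum>w\<in>A ` B. sc (u w) w) = 0" and b: "b \<in> B" "u (A b) \<noteq> 0"
    have "A (\<Sum>b\<in>B. sc (u (A b)) b) = A 0" using s comb A0 by simp
    then have "(\<Sum>b\<in>B. sc (u (A b)) b) = 0"
      using injS combS sub subspace_0 by (simp add: inj_on_def)
    then show False
      using B(1) b dependent_finite[OF B(2)] by auto
  qed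
  show sp: "span (A ` B) = S'"
  proof
    show "span (A ` B) \<subseteq> S'"
    proof
      fix w assume "w \<in> span (A ` B)"
      then obtain u where w: "w = (\<Sum>v\<in>A ` B. sc (u v) v)"
        unfolding span_finite[OF finite_imageI[OF B(2)]] by blast
      show "w \<in> S'"
        unfolding w comb[of u] using combS[of "\<lambda>b. u (A b)"] A(2) bij_betwE by blast
    qed
    show "S' \<subseteq> span (A ` B)"
    proof
      fix w assume "w \<in> S'"
      then obtain v where v: "v \<in> S" "w = A v" using bij_betw_imp_surj_on[OF A(2)] by blast
      have "v = (\<Sum>b\<in>B. sc (representation B v b) b)"
        using sum_representation_eq[of B v B] B v by auto
      then have "w = (\<Sum>b\<in>B. sc (representation B v b) (A b))"
        using lin_on_sum[OF sub A(1) B(2), of "\<lambda>b. b" "representation B v"] BS v by auto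
      then show "w \<in> span (A ` B)"
        by (simp only:) (intro span_sum span_scale span_base imageI)
    qed
  qed
  fix v b assume v: "v \<in> S" and b: "b \<in> B"
  have Av: "A v \<in> span (A ` B)" using sp v A(2) bij_betwE by blast
  have "v = (\<Sum>b\<in>B. sc (representation B v b) b)"
    using sum_representation_eq[of B v B] B v by auto
  then have "A v = (\<Sum>b\<in>B. sc (representation B v b) (A b))"
    using lin_on_sum[OF sub A(1) B(2), of "\<lambda>b. b" "representation B v"] BS by auto
  then have "representation (A ` B) (A v) (A b)
      = (\<Sum>b'\<in>B. representation B v b' * representation (A ` B) (A b') (A b))"
    using ind by (simp add: representation_lincomb span_base)
  also have "\<dots> = (\<Sum>b'\<in>B. representation B v b' * (if b = b' then 1 else 0))"
    using b inj by (intro sum.cong refl) (auto simp: representation_basis[OF ind] inj_on_def)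
  also have "\<dots> = representation B v b"
    using b B(2) by (simp add: if_distrib sum.delta cong: if_cong)
  finally show "representation (A ` B) (A v) (A b) = representation B v b" .
qed

text \<open>Conjugation invariance of the trace: in \<open>B\<close> and in its image under
  \<open>A\<close> the two maps have the same matrix. Linearity of \<open>f'\<close> on
  \<open>S'\<close> is derived from the intertwining relation.\<close>

lemma trace_on_transport:
  assumes B: "independent B" "finite B" "span B = S"
    and A: "lin_on S A" "bij_betw A S S'"
    and f: "lin_on S f" "f ` S \<subseteq> S"
    and f': "\<And>w. w \<in> S \<Longrightarrow> f' (A w) = A (f w)"
  shows "trace_on sc S' f' = trace_on sc S f"
proof -
  note im = basis_image[OF B A]
  have sub: "subspace S" using B(3) by auto
  have BS: "B \<subseteq> S" using B(3) span_superset by auto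
  have S': "S' = A ` S" using bij_betw_imp_surj_on[OF A(2)] by simp
  have "lin_on S' f'"
    unfolding lin_on_def S'
  proof (intro conjI ballI allI)
    fix x y assume "x \<in> A ` S" "y \<in> A ` S"
    then obtain x0 y0 where 0: "x0 \<in> S" "y0 \<in> S" "x = A x0" "y = A y0" by auto
    have "x + y = A (x0 + y0)" using 0 A(1) by (simp add: lin_on_def)
    then have "f' (x + y) = A (f (x0 + y0))" using 0 f' sub subspace_add by simp
    then show "f' (x + y) = f' x + f' y"
      using 0 f A(1) f' by (simp add: lin_on_def image_subset_iff)
  next
    fix c x assume "x \<in> A ` S"
    then obtain x0 where 0: "x0 \<in> S" "x = A x0" by auto
    have "sc c x = A (sc c x0)" using 0 A(1) by (simp add: lin_on_def)
    then have "f' (sc c x) = A (f (sc c x0))" using 0 f' sub subspace_scale by simp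
    then show "f' (sc c x) = sc c (f' x)"
      using 0 f A(1) f' by (simp add: lin_on_def image_subset_iff)
  qed
  moreover have "f' ` S' \<subseteq> S'" using f(2) f' S' by auto
  ultimately have "trace_on sc S' f' = (\<Sum>b\<in>A ` B. representation (A ` B) (f' b) b)"
    using im B(2) by (intro trace_on_basis) auto
  also have "\<dots> = (\<Sum>b\<in>B. representation (A ` B) (A (f b)) (A b))"
    using f' BS by (simp add: sum.reindex[OF im(3)] subset_iff)
  also have "\<dots> = (\<Sum>b\<in>B. representation B (f b) b)"
    using im(4) f(2) BS by (intro sum.cong refl) (auto simp: image_subset_iff subset_iff)
  also have "\<dots> = trace_on sc S f" using trace_on_basis[OF B f] by simp
  finally show ?thesis .
qed

lemma trace_on_scale:
  assumes B: "independent B" "finite B" "span B = S"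
    and f: "lin_on S f" "f ` S \<subseteq> S"
  shows "trace_on sc S (\<lambda>w. sc c (f w)) = c * trace_on sc S f"
proof -
  have sub: "subspace S" using B(3) by auto
  have BS: "B \<subseteq> S" using B(3) span_superset by auto
  have "lin_on S (\<lambda>w. sc c (f w))"
    using f by (simp add: lin_on_def scale_right_distrib scale_left_commute)
  moreover have "(\<lambda>w. sc c (f w)) ` S \<subseteq> S"
    using f(2) sub subspace_scale by blast
  ultimately have "trace_on sc S (\<lambda>w. sc c (f w)) = (\<Sum>b\<in>B. representation B (sc c (f b)) b)"
    using B by (intro trace_on_basis)
  also have "\<dots> = (\<Sum>b\<in>B. c * representation B (f b) b)"
    using B f BS by (intro sum.cong refl) (subst representation_scale, auto)
  finally show ?thesis using trace_on_basis[OF B f] by (simp add: sum_distrib_left)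
qed

text \<open>Bases of the blocks together form a basis of the sum, which is direct by
  \<open>direct\<close>. A block that \<open>f\<close> sends to a different block contributes only
  off-diagonal entries, hence nothing to the trace.\<close>

lemma trace_on_permuted_blocks:
  assumes "finite I"
    and B: "\<And>i. i \<in> I \<Longrightarrow> independent (B i)" "\<And>i. i \<in> I \<Longrightarrow> finite (B i)"
      "\<And>i. i \<in> I \<Longrightarrow> span (B i) = S i"
    and direct: "\<And>w. (\<And>i. i \<in> I \<Longrightarrow> w i \<in> S i) \<Longrightarrow> (\<Sum>i\<in>I. w i) = 0 \<Longrightarrow> \<forall>i\<in>I. w i = 0"
    and f: "lin_on (span (\<Union>i\<in>I. S i)) f"
    and \<sigma>: "\<And>i. i \<in> I \<Longrightarrow> \<sigma> i \<in> I" "\<And>i. i \<in> I \<Longrightarrow> f ` S i \<subseteq> S (\<sigma> i)"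
  shows "trace_on sc (span (\<Union>i\<in>I. S i)) f = (\<Sum>i\<in>{i\<in>I. \<sigma> i = i}. trace_on sc (S i) f)"
proof -
  have BS: "b \<in> S i" if "b \<in> B i" "i \<in> I" for b i using B(3) span_superset that by blast
  have sub: "subspace (S i)" if "i \<in> I" for i using B(3) that by (metis subspace_span)
  have disj: "i = j" if "i \<in> I" "j \<in> I" "b \<in> B i" "b \<in> B j" for i j b
  proof (rule ccontr)
    assume ne: "i \<noteq> j"
    \<comment> \<open>A vector common to two blocks, taken with opposite signs, would be a
      nontrivial relation between them.\<close>
    define w where "w k = (if k = i then b else if k = j then - b else 0)" for k
    have "(\<Sum>k\<in>I. w k) = (\<Sum>k\<in>{i, j}. w k)"
      using that by (intro sum.mono_neutral_right assms(1)) (auto simp: w_def)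
    then have "(\<Sum>k\<in>I. w k) = 0" using ne by (simp add: w_def)
    moreover have "w k \<in> S k" if "k \<in> I" for k
      using that \<open>i \<in> I\<close> \<open>j \<in> I\<close> BS \<open>b \<in> B i\<close> \<open>b \<in> B j\<close> sub
      by (simp add: w_def subspace_neg subspace_0)
    ultimately have "w i = 0" using direct that by blast
    then have "b = 0" by (simp add: w_def)
    then show False using B(1) that dependent_zero by blast
  qed
  define D where "D = (\<Union>i\<in>I. B i)"
  have finD: "finite D" using assms(1) B(2) by (simp add: D_def)
  have "\<forall>i\<in>I. finite (B i)" "\<forall>i\<in>I. \<forall>j\<in>I. i \<noteq> j \<longrightarrow> B i \<inter> B j = {}"
    using B(2) disj by blast+
  note sumD = sum.UNION_disjoint[OF assms(1) this, folded D_def]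
  have indD: "independent D"
    unfolding dependent_finite[OF finD]
  proof clarify
    fix u b assume s: "(\<Sum>b\<in>D. sc (u b) b) = 0" and b: "b \<in> D" "u b \<noteq> 0"
    obtain i where i: "i \<in> I" "b \<in> B i" using b D_def by auto
    have "(\<Sum>i\<in>I. \<Sum>b\<in>B i. sc (u b) b) = 0" using s by (simp only: sumD)
    moreover have "(\<Sum>b\<in>B i. sc (u b) b) \<in> S i" if "i \<in> I" for i
      using that BS by (intro subspace_sum subspace_scale sub) auto
    ultimately have "\<forall>i\<in>I. (\<Sum>b\<in>B i. sc (u b) b) = 0"
      by (intro direct[of "\<lambda>i. \<Sum>b\<in>B i. sc (u b) b"])
    then have "(\<Sum>b\<in>B i. sc (u b) b) = 0" using i(1) by blast
    then show False using B(1,2) i b dependent_finite by blast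
  qed
  have spanD: "span D = span (\<Union>i\<in>I. S i)"
  proof (rule span_eq[THEN iffD2], intro conjI)
    show "D \<subseteq> span (\<Union>i\<in>I. S i)" using BS by (auto simp: D_def intro!: span_base)
    have "S i \<subseteq> span D" if "i \<in> I" for i
      using span_mono[of "B i" D] B(3) that by (auto simp: D_def)
    then show "(\<Union>i\<in>I. S i) \<subseteq> span D" by blast
  qed
  have f_map: "f ` span (\<Union>i\<in>I. S i) \<subseteq> span (\<Union>i\<in>I. S i)"
  proof
    fix w assume "w \<in> f ` span (\<Union>i\<in>I. S i)"
    then obtain v where v: "v \<in> span D" "w = f v" using spanD by auto
    have "f v = f (\<Sum>b\<in>D. sc (representation D v b) b)"
      using sum_representation_eq[of D v D] indD finD v by auto
    also have "\<dots> = (\<Sum>b\<in>D. sc (representation D v b) (f b))"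
      by (intro lin_on_sum[OF subspace_span f finD]) (use spanD span_base in blast)
    also have "\<dots> \<in> span (\<Union>i\<in>I. S i)"
    proof (intro span_sum span_scale)
      fix b assume "b \<in> D"
      then obtain i where "i \<in> I" "b \<in> B i" by (auto simp: D_def)
      then have "f b \<in> S (\<sigma> i)" "\<sigma> i \<in> I" using \<sigma> BS by blast+
      then show "f b \<in> span (\<Union>i\<in>I. S i)" by (blast intro: span_base)
    qed
    finally show "w \<in> span (\<Union>i\<in>I. S i)" using v by simp
  qed
  have block: "(\<Sum>b\<in>B i. representation D (f b) b) = (if \<sigma> i = i then trace_on sc (S i) f else 0)"
    if i: "i \<in> I" for i
  proof -
    \<comment> \<open>\<open>f b\<close> lies in the block \<open>S (\<sigma> i)\<close>, so its
      coordinates in \<open>D\<close> are those in \<open>B (\<sigma> i)\<close>.\<close>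
    have "representation D (f b) b = representation (B (\<sigma> i)) (f b) b" if "b \<in> B i" for b
    proof -
      have "f b \<in> span (B (\<sigma> i))" using \<sigma> i B(3) BS that by blast
      then show ?thesis
        using representation_extend[OF indD] \<sigma>(1)[OF i] by (fastforce simp: D_def)
    qed
    note rep = this
    show ?thesis
    proof (cases "\<sigma> i = i")
      case True
      have "lin_on (S i) f"
        using f i span_base[of _ "\<Union>i\<in>I. S i"] unfolding lin_on_def by blast
      then have "trace_on sc (S i) f = (\<Sum>b\<in>B i. representation (B i) (f b) b)"
        using \<sigma>(2)[OF i] True B i by (intro trace_on_basis) auto
      then show ?thesis using rep True by simp
    next
      case False
      \<comment> \<open>The bases of different blocks are disjoint, so \<open>b\<close> is not a
        basis vector of the target block and its coordinate there is 0 by default.\<close>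
      have "representation (B (\<sigma> i)) (f b) b = 0" if "b \<in> B i" for b
        using disj[OF i \<sigma>(1)[OF i] that] False representation_ne_zero by metis
      then show ?thesis using rep False by simp
    qed
  qed
  have "trace_on sc (span (\<Union>i\<in>I. S i)) f = (\<Sum>b\<in>D. representation D (f b) b)"
    by (intro trace_on_basis indD finD spanD f f_map)
  also have "\<dots> = (\<Sum>i\<in>I. if \<sigma> i = i then trace_on sc (S i) f else 0)"
    using block by (simp add: sumD)
  also have "\<dots> = (\<Sum>i\<in>{i\<in>I. \<sigma> i = i}. trace_on sc (S i) f)"
    using assms(1) by (simp add: sum.inter_filter)
  finally show ?thesis .
qed

section \<open>Norms of coordinate vectors and of matrices\<close>

definition coord_norm :: "'w set \<Rightarrow> 'w \<Rightarrow> real" where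
  "coord_norm B w = (\<Sum>b\<in>B. norm (representation B w b))"

text \<open>For \<open>f\<close> preserving the span of \<open>B\<close>, the sum of the absolute
  values of all matrix entries. It is submultiplicative and bounds the trace directly.\<close>

definition op_norm :: "'w set \<Rightarrow> ('w \<Rightarrow> 'w) \<Rightarrow> real" where
  "op_norm B f = (\<Sum>b\<in>B. coord_norm B (f b))"

lemma coord_norm_nonneg: "0 \<le> coord_norm B w"
  by (simp add: coord_norm_def sum_nonneg)

lemma op_norm_nonneg: "0 \<le> op_norm B f"
  by (simp add: op_norm_def sum_nonneg coord_norm_nonneg)

lemma coord_norm_scale:
  "independent B \<Longrightarrow> w \<in> span B \<Longrightarrow> coord_norm B (sc c w) = norm c * coord_norm B w"
  by (simp add: coord_norm_def representation_scale norm_mult sum_distrib_left)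

lemma coord_norm_map_le:
  assumes B: "independent B" "finite B" "span B = S"
    and f: "lin_on S f" "f ` S \<subseteq> S" and w: "w \<in> S"
  shows "coord_norm B (f w) \<le> op_norm B f * coord_norm B w"
proof -
  have BS: "B \<subseteq> S" using B(3) span_superset by auto
  have fB: "f b \<in> span B" if "b \<in> B" for b using that BS f(2) B(3) by auto
  let ?r = "representation B w"
  have "w = (\<Sum>b\<in>B. sc (?r b) b)" using sum_representation_eq[of B w B] B w by auto
  then have "f w = (\<Sum>b\<in>B. sc (?r b) (f b))"
    using lin_on_sum[OF _ f(1) B(2), of "\<lambda>b. b" ?r] B(3) BS by auto
  then have "representation B (f w) b' = (\<Sum>b\<in>B. ?r b * representation B (f b) b')" for b'
    using B(1) fB by (simp add: representation_lincomb)
  then have "coord_norm B (f w) \<le> (\<Sum>b'\<in>B. \<Sum>b\<in>B. norm (?r b) * norm (representation B (f b) b'))"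
    unfolding coord_norm_def by (intro sum_mono) (simp add: sum_norm_le norm_mult)
  also have "\<dots> = (\<Sum>b\<in>B. norm (?r b) * coord_norm B (f b))"
    unfolding coord_norm_def sum_distrib_left by (rule sum.swap)
  also have "\<dots> \<le> (\<Sum>b\<in>B. norm (?r b) * op_norm B f)"
    unfolding op_norm_def using B(2)
    by (intro sum_mono mult_left_mono member_le_sum) (auto simp: coord_norm_nonneg)
  also have "\<dots> = op_norm B f * coord_norm B w"
    by (simp add: coord_norm_def mult.commute flip: sum_distrib_left)
  finally show ?thesis .
qed

lemma op_norm_compose_le:
  assumes B: "independent B" "finite B" "span B = S"
    and f: "lin_on S f" "f ` S \<subseteq> S" and g: "g ` S \<subseteq> S"
  shows "op_norm B (\<lambda>w. f (g w)) \<le> op_norm B f * op_norm B g"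
proof -
  have "g b \<in> S" if "b \<in> B" for b using g that B(3) span_superset by blast
  then have "op_norm B (\<lambda>w. f (g w)) \<le> (\<Sum>b\<in>B. op_norm B f * coord_norm B (g b))"
    unfolding op_norm_def[of B "\<lambda>w. f (g w)"] by (intro sum_mono coord_norm_map_le[OF B f])
  then show ?thesis by (simp add: op_norm_def[of B g] sum_distrib_left)
qed

lemma op_norm_scale:
  assumes B: "independent B" "span B = S" and f: "f ` S \<subseteq> S"
  shows "op_norm B (\<lambda>w. sc c (f w)) = norm c * op_norm B f"
proof -
  have "f b \<in> span B" if "b \<in> B" for b using f that B(2) span_superset by blast
  then show ?thesis by (simp add: op_norm_def coord_norm_scale[OF B(1)] sum_distrib_left)
qed

lemma norm_trace_on_le:
  assumes B: "independent B" "finite B" "span B = S" and f: "lin_on S f" "f ` S \<subseteq> S"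
  shows "norm (trace_on sc S f) \<le> op_norm B f"
proof -
  have "norm (trace_on sc S f) \<le> (\<Sum>b\<in>B. norm (representation B (f b) b))"
    unfolding trace_on_basis[OF B f] by (rule norm_sum)
  also have "\<dots> \<le> (\<Sum>b\<in>B. coord_norm B (f b))"
    unfolding coord_norm_def using B(2) by (intro sum_mono member_le_sum) auto
  finally show ?thesis by (simp add: op_norm_def)
qed

end

section \<open>Lattices and discrete subgroups\<close>

text \<open>Closure under differences is the form in which \<open>complement_sublattice\<close>
  states it; sums and negatives are derived.\<close>

definition add_subgroup :: "'a::ab_group_add set \<Rightarrow> bool" where
  "add_subgroup G \<longleftrightarrow> 0 \<in> G \<and> (\<forall>x\<in>G. \<forall>y\<in>G. x - y \<in> G)"

lemma add_subgroup_diff: "add_subgroup G \<Longrightarrow> x \<in> G \<Longrightarrow> y \<in> G \<Longrightarrow> x - y \<in> G"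
  by (simp add: add_subgroup_def)

lemma add_subgroup_zero: "add_subgroup G \<Longrightarrow> 0 \<in> G"
  by (simp add: add_subgroup_def)

lemma add_subgroup_minus: "add_subgroup G \<Longrightarrow> x \<in> G \<Longrightarrow> - x \<in> G"
  using add_subgroup_diff[of G 0 x] by (simp add: add_subgroup_zero)

lemma add_subgroup_add: "add_subgroup G \<Longrightarrow> x \<in> G \<Longrightarrow> y \<in> G \<Longrightarrow> x + y \<in> G"
  using add_subgroup_diff[of G x "- y"] by (simp add: add_subgroup_minus)

lemma add_subgroup_sum:
  "add_subgroup G \<Longrightarrow> (\<And>i. i \<in> I \<Longrightarrow> x i \<in> G) \<Longrightarrow> (\<Sum>i\<in>I. x i) \<in> G"
  by (induction I rule: infinite_finite_induct) (auto simp: add_subgroup_zero add_subgroup_add)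

lemma add_subgroup_of_nat_scaleR:
  fixes G :: "'a::real_vector set"
  shows "add_subgroup G \<Longrightarrow> x \<in> G \<Longrightarrow> of_nat k *\<^sub>R x \<in> G"
  by (induction k) (auto simp: add_subgroup_zero add_subgroup_add scaleR_left_distrib)

lemma add_subgroup_of_int_scaleR:
  fixes G :: "'a::real_vector set"
  assumes "add_subgroup G" "x \<in> G"
  shows "of_int k *\<^sub>R x \<in> G"
proof (cases k rule: int_cases2)
  case (nonneg n)
  then show ?thesis using add_subgroup_of_nat_scaleR[OF assms] by simp
next
  case (nonpos n)
  then show ?thesis
    using add_subgroup_minus[OF assms(1) add_subgroup_of_nat_scaleR[OF assms]] by simp
qed

text \<open>Coordinate functionals on a finite-dimensional space are continuous. Since
  \<open>B\<close> may fail to span and \<open>representation B\<close> is 0 outside its span,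
  boundedness is obtained for a basis \<open>E\<close> of the whole space and then
  restricted.\<close>

lemma representation_bounded:
  fixes B :: "'a::euclidean_space set"
  assumes "independent B"
  obtains K where "K \<ge> 0" "\<And>x b. x \<in> span B \<Longrightarrow> \<bar>representation B x b\<bar> \<le> K * norm x"
proof -
  define E where "E = extend_basis B"
  have E: "B \<subseteq> E" "independent E" "span E = UNIV"
    using assms extend_basis_superset independent_extend_basis span_extend_basis
    by (auto simp: E_def)
  have finE: "finite E" using E(2) by (rule independent_imp_finite)
  have "linear (\<lambda>x. representation E x b)" for b
    using E(2,3) by (intro linearI) (simp_all add: representation_add representation_scale)
  then have "\<exists>K>0. \<forall>x. \<bar>representation E x b\<bar> \<le> norm x * K" for b
    using bounded_linear.pos_bounded[of "\<lambda>x. representation E x b"]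
    by (simp add: linear_conv_bounded_linear)
  then obtain K where K: "\<And>b. K b > 0" "\<And>b x. \<bar>representation E x b\<bar> \<le> norm x * K b"
    by metis
  show ?thesis
  proof (rule that[of "\<Sum>b\<in>E. K b"])
    show "0 \<le> sum K E" using K(1) by (intro sum_nonneg) (auto intro: less_imp_le)
    fix x b assume x: "x \<in> span B"
    have eq: "representation B x = representation E x"
      using representation_extend[OF E(2) x E(1)] by simp
    show "\<bar>representation B x b\<bar> \<le> sum K E * norm x"
    proof (cases "b \<in> E")
      case True
      have "K b \<le> sum K E"
        using member_le_sum[OF True, of K] K(1) finE by (auto intro: less_imp_le)
      then have "norm x * K b \<le> norm x * sum K E" by (simp add: mult_left_mono)
      then show ?thesis using K(2)[of x b] eq by (simp add: mult.commute)
    next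
      case False
      then have "representation B x b = 0"
        using representation_ne_zero[of E x b] eq by auto
      moreover have "0 \<le> sum K E" using K(1) by (intro sum_nonneg) (auto intro: less_imp_le)
      ultimately show ?thesis by simp
    qed
  qed
qed

text \<open>The basis behind \<open>full_lattice\<close> becomes usable through its coordinate
  functionals, which are bounded everywhere and integral on \<open>L\<close>. Integrality is
  expressed by the floor, which turns lattice points into integer tuples.\<close>

lemma full_lattice_coordinates:
  assumes "full_lattice L"
  obtains B K where "independent B" "finite B" "span B = UNIV" "B \<subseteq> L" "add_subgroup L" "K \<ge> 0"
    "\<And>x b. \<bar>representation B x b\<bar> \<le> K * norm x"
    "\<And>x b. x \<in> L \<Longrightarrow> b \<in> B \<Longrightarrow> of_int \<lfloor>representation B x b\<rfloor> = representation B x b"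
proof -
  obtain B where B: "independent B" "span B = UNIV"
    "L = {(\<Sum>b\<in>B. of_int (c b) *\<^sub>R b) | c :: real ^ 'a \<Rightarrow> int. True}"
    using assms unfolding full_lattice_def by blast
  have finB: "finite B" using B(1) by (rule independent_imp_finite)
  obtain K where K: "K \<ge> 0" "\<And>x b. \<bar>representation B x b\<bar> \<le> K * norm x"
    using representation_bounded[OF B(1)] B(2) by auto
  show thesis
  proof (rule that[OF B(1) finB B(2) _ _ K])
    show "B \<subseteq> L"
    proof
      fix b assume "b \<in> B"
      then have "b = (\<Sum>b'\<in>B. of_int (if b' = b then 1 else 0) *\<^sub>R b')"
        using finB by (simp add: if_distrib[of "\<lambda>x. x *\<^sub>R _"] if_distrib[of of_int] sum.delta cong: if_cong)
      then show "b \<in> L" unfolding B(3)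
        by (intro CollectI exI[of _ "\<lambda>b'. if b' = b then 1 else 0"]) simp
    qed
    show "add_subgroup L" unfolding add_subgroup_def
    proof (intro conjI ballI)
      have "(\<Sum>b\<in>B. of_int (0 :: int) *\<^sub>R b) \<in> L" unfolding B(3) by (auto intro!: exI[of _ "\<lambda>b. 0"])
      then show "0 \<in> L" by simp
      fix x y assume "x \<in> L" "y \<in> L"
      then obtain c d where "x = (\<Sum>b\<in>B. of_int (c b) *\<^sub>R b)" "y = (\<Sum>b\<in>B. of_int (d b) *\<^sub>R b)"
        unfolding B(3) by blast
      then have "x - y = (\<Sum>b\<in>B. of_int (c b - d b) *\<^sub>R b)"
        by (simp add: sum_subtractf scaleR_left_diff_distrib)
      then show "x - y \<in> L" unfolding B(3) by (intro CollectI exI[of _ "\<lambda>b. c b - d b"]) simp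
    qed
    fix x b assume x: "x \<in> L" and b: "b \<in> B"
    obtain c where c: "x = (\<Sum>b\<in>B. of_int (c b) *\<^sub>R b)"
      using x unfolding B(3) by blast
    have "representation B x b = (\<Sum>b'\<in>B. of_int (c b') * representation B b' b)"
      unfolding c using B by (simp add: representation_sum representation_scale)
    also have "\<dots> = (\<Sum>b'\<in>B. of_int (c b') * (if b = b' then 1 else 0))"
      by (intro sum.cong refl) (simp add: representation_basis[OF B(1)])
    also have "\<dots> = of_int (c b)" using b finB by (simp add: if_distrib sum.delta cong: if_cong)
    finally show "of_int \<lfloor>representation B x b\<rfloor> = representation B x b" by simp
  qed
qed

lemma full_lattice_add_subgroup: "full_lattice L \<Longrightarrow> add_subgroup L"
  using full_lattice_coordinates by metis

lemma representation_inj: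
  fixes B :: "'a::real_vector set"
  assumes "independent B" "finite B" "span B = UNIV"
    and "\<And>b. b \<in> B \<Longrightarrow> representation B x b = representation B y b"
  shows "x = y"
proof -
  have "x = (\<Sum>b\<in>B. representation B x b *\<^sub>R b)"
    using sum_representation_eq[of B x B] assms by simp
  also have "\<dots> = (\<Sum>b\<in>B. representation B y b *\<^sub>R b)"
    by (intro sum.cong refl) (simp add: assms(4))
  also have "\<dots> = y"
    using sum_representation_eq[of B y B] assms by simp
  finally show ?thesis .
qed

lemma full_lattice_floor_coordinates_inj:
  assumes "independent B" "finite B" "span B = UNIV"
    and "\<And>x b. x \<in> L \<Longrightarrow> b \<in> B \<Longrightarrow> of_int \<lfloor>representation B x b\<rfloor> = representation B x b"
  shows "inj_on (\<lambda>x. restrict (\<lambda>b. \<lfloor>representation B x b\<rfloor>) B) L"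
proof (rule inj_onI)
  fix x y assume xy: "x \<in> L" "y \<in> L"
    "restrict (\<lambda>b. \<lfloor>representation B x b\<rfloor>) B = restrict (\<lambda>b. \<lfloor>representation B y b\<rfloor>) B"
  show "x = y"
  proof (rule representation_inj[OF assms(1-3)])
    fix b assume b: "b \<in> B"
    then have "\<lfloor>representation B x b\<rfloor> = \<lfloor>representation B y b\<rfloor>"
      using fun_cong[OF xy(3), of b] by simp
    then show "representation B x b = representation B y b"
      using assms(4) xy(1,2) b by metis
  qed
qed

text \<open>Bounded vectors have bounded integer coordinates, and a box contains finitely many
  integer tuples.\<close>

lemma full_lattice_finite_ball:
  assumes "full_lattice L"
  shows "finite {x\<in>L. norm x \<le> R}"
proof -
  obtain B K where B: "independent B" "finite B" "span B = UNIV" "B \<subseteq> L" "add_subgroup L" "K \<ge> 0"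
    "\<And>x b. \<bar>representation B x b\<bar> \<le> K * norm x"
    "\<And>x b. x \<in> L \<Longrightarrow> b \<in> B \<Longrightarrow> of_int \<lfloor>representation B x b\<rfloor> = representation B x b"
    using full_lattice_coordinates[OF assms] by blast
  define F where "F x = restrict (\<lambda>b. \<lfloor>representation B x b\<rfloor>) B" for x
  define S where "S = {x\<in>L. norm x \<le> R}"
  have "inj_on F S"
    using full_lattice_floor_coordinates_inj[OF B(1-3,8)] unfolding F_def S_def
    by (rule inj_on_subset) auto
  moreover have "F ` S \<subseteq> PiE B (\<lambda>_. {- \<lceil>K * R\<rceil> - 1..\<lceil>K * R\<rceil>})"
  proof (intro image_subsetI)
    fix x assume x: "x \<in> S"
    have "\<lfloor>representation B x b\<rfloor> \<in> {- \<lceil>K * R\<rceil> - 1..\<lceil>K * R\<rceil>}" for b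
    proof -
      have "\<bar>representation B x b\<bar> \<le> K * R"
        using B(7)[of x b] x B(6) mult_left_mono[of "norm x" R K] by (simp add: S_def)
      then show ?thesis by auto linarith+
    qed
    then show "F x \<in> PiE B (\<lambda>_. {- \<lceil>K * R\<rceil> - 1..\<lceil>K * R\<rceil>})"
      unfolding F_def by (intro restrict_PiE_iff[THEN iffD2] ballI)
  qed
  moreover have "finite (PiE B (\<lambda>_. {- \<lceil>K * R\<rceil> - 1..\<lceil>K * R\<rceil>}))"
    using B(2) by (intro finite_PiE) auto
  ultimately show ?thesis unfolding S_def[symmetric]
    by (meson finite_imageD finite_subset)
qed

section \<open>Gaussian sums over a lattice\<close>

lemma summable_on_exp_neg_abs_int: "(\<lambda>k. exp (- real_of_int \<bar>k\<bar>)) summable_on (UNIV :: int set)"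
proof -
  have "summable (\<lambda>n. exp (-1 :: real) ^ n)" by (intro summable_geometric) simp
  moreover have "exp (- real n) = exp (-1) ^ n" for n
    by (simp flip: exp_of_nat_mult)
  ultimately have nat: "(\<lambda>n::nat. exp (- real n)) summable_on UNIV"
    by (intro norm_summable_imp_summable_on) simp
  have "(\<lambda>k. exp (- real_of_int \<bar>k\<bar>)) summable_on range int"
    by (subst summable_on_reindex) (use nat in \<open>auto simp: o_def\<close>)
  \<comment> \<open>The shift by one keeps the negative half disjoint from the range of
    \<open>int\<close>; it costs a factor \<open>exp (-1)\<close>.\<close>
  moreover have "(\<lambda>k. exp (- real_of_int \<bar>k\<bar>)) summable_on range (\<lambda>n. - int n - 1)"
  proof (subst summable_on_reindex)
    have "(\<lambda>n::nat. exp (-1) * exp (- real n)) summable_on UNIV"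
      using nat by (rule summable_on_cmult_right)
    then show "((\<lambda>k. exp (- real_of_int \<bar>k\<bar>)) \<circ> (\<lambda>n. - int n - 1)) summable_on UNIV"
      by (simp add: o_def abs_if flip: exp_add)
  qed (auto simp: inj_def)
  ultimately have "(\<lambda>k. exp (- real_of_int \<bar>k\<bar>)) summable_on (range int \<union> range (\<lambda>n. - int n - 1))"
    by (rule summable_on_Un_disjoint) auto
  moreover have "range int \<union> range (\<lambda>n. - int n - 1) = UNIV"
  proof (intro equalityI subsetI UNIV_I)
    fix k :: int
    show "k \<in> range int \<union> range (\<lambda>n. - int n - 1)"
    proof (cases "k \<ge> 0")
      case True
      then show ?thesis by (intro UnI1 image_eqI[of _ _ "nat k"]) auto
    next
      case False
      then show ?thesis by (intro UnI2 image_eqI[of _ _ "nat (- k - 1)"]) auto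
    qed
  qed
  ultimately show ?thesis by simp
qed

text \<open>The quadratic exponent absorbs any linear term, so each summand is at most a constant
  times the product of \<open>exp (- \<bar>k\<bar>)\<close> over its coordinates \<open>k\<close>.
  Sums of such products over boxes factor into one-dimensional sums.\<close>

lemma full_lattice_gaussian_summable:
  assumes "full_lattice L" "a > 0"
  shows "(\<lambda>x. exp (- a * (norm x)\<^sup>2 + c * norm x)) summable_on L"
proof -
  obtain B K where B: "independent B" "finite B" "span B = UNIV" "B \<subseteq> L" "add_subgroup L" "K \<ge> 0"
    "\<And>x b. \<bar>representation B x b\<bar> \<le> K * norm x"
    "\<And>x b. x \<in> L \<Longrightarrow> b \<in> B \<Longrightarrow> of_int \<lfloor>representation B x b\<rfloor> = representation B x b"
    using full_lattice_coordinates[OF assms(1)] by blast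
  define k where "k x b = \<lfloor>representation B x b\<rfloor>" for x b
  define E where "E j = exp (- real_of_int \<bar>j\<bar>)" for j
  define S where "S = infsum E UNIV"
  have E: "E summable_on UNIV" unfolding E_def by (rule summable_on_exp_neg_abs_int)
  \<comment> \<open>\<open>m\<close> is the rate \<open>c\<close> enlarged to pay for the sum of the
    absolute coordinates, which is at most \<open>card B * K * norm x\<close>; \<open>D\<close> is
    the maximum of \<open>m * t - a * t\<^sup>2\<close> over real \<open>t\<close>.\<close>
  define m where "m = c + of_nat (card B) * K"
  define D where "D = m\<^sup>2 / (4 * a)"
  have bound: "exp (- a * (norm x)\<^sup>2 + c * norm x) \<le> exp D * (\<Prod>b\<in>B. E (k x b))" if "x \<in> L" for x
  proof -
    have "(\<Sum>b\<in>B. \<bar>representation B x b\<bar>) \<le> of_nat (card B) * (K * norm x)"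
      using B(7) by (intro sum_bounded_above) auto
    then have 1: "c * norm x \<le> m * norm x - (\<Sum>b\<in>B. \<bar>representation B x b\<bar>)"
      by (simp add: m_def algebra_simps)
    have "0 \<le> a * (norm x - m / (2 * a))\<^sup>2" using assms(2) by simp
    also have "\<dots> = a * (norm x)\<^sup>2 - m * norm x + D"
      using assms(2) by (simp add: D_def power2_eq_square field_simps)
    finally have "- a * (norm x)\<^sup>2 + c * norm x \<le> D - (\<Sum>b\<in>B. \<bar>representation B x b\<bar>)"
      using 1 by simp
    then have "exp (- a * (norm x)\<^sup>2 + c * norm x)
        \<le> exp (D - (\<Sum>b\<in>B. \<bar>representation B x b\<bar>))"
      by simp
    also have "(\<Sum>b\<in>B. \<bar>representation B x b\<bar>) = (\<Sum>b\<in>B. real_of_int \<bar>k x b\<bar>)"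
      unfolding k_def of_int_abs using B(8)[OF that] by (intro sum.cong refl) metis
    also have "D - (\<Sum>b\<in>B. real_of_int \<bar>k x b\<bar>) = D + (\<Sum>b\<in>B. - real_of_int \<bar>k x b\<bar>)"
      by (simp only: sum_negf diff_conv_add_uminus)
    also have "exp (D + (\<Sum>b\<in>B. - real_of_int \<bar>k x b\<bar>)) = exp D * (\<Prod>b\<in>B. E (k x b))"
      using B(2) by (simp only: E_def exp_add exp_sum)
    finally show ?thesis .
  qed
  show ?thesis
  proof (rule nonneg_bdd_above_summable_on)
    show "bdd_above (sum (\<lambda>x. exp (- a * (norm x)\<^sup>2 + c * norm x)) ` {F. F \<subseteq> L \<and> finite F})"
    proof (rule bdd_aboveI2[where M = "exp D * S ^ card B"], clarify)
      fix F assume F: "F \<subseteq> L" "finite F"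
      have inj: "inj_on (\<lambda>x. restrict (k x) B) F"
        using full_lattice_floor_coordinates_inj[OF B(1-3,8)] F(1) unfolding k_def
        by (rule inj_on_subset)
      \<comment> \<open>The product of the sets \<open>J b\<close> is a finite box containing the
        tuples of \<open>F\<close>; each one-dimensional sum over \<open>J b\<close> is at most
        \<open>S\<close>, whatever \<open>F\<close> is.\<close>
      define J where "J b = (\<lambda>x. k x b) ` F" for b
      have "(\<Sum>x\<in>F. exp (- a * (norm x)\<^sup>2 + c * norm x)) \<le> (\<Sum>x\<in>F. exp D * (\<Prod>b\<in>B. E (k x b)))"
        using F bound by (intro sum_mono) auto
      also have "\<dots> = exp D * (\<Sum>x\<in>F. \<Prod>b\<in>B. E (restrict (k x) B b))"
        by (simp add: sum_distrib_left)
      also have "(\<Sum>x\<in>F. \<Prod>b\<in>B. E (restrict (k x) B b))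
          = (\<Sum>j\<in>(\<lambda>x. restrict (k x) B) ` F. \<Prod>b\<in>B. E (j b))"
        by (simp add: sum.reindex[OF inj])
      also have "\<dots> \<le> (\<Sum>j\<in>PiE B J. \<Prod>b\<in>B. E (j b))"
        using F(2) B(2)
        by (intro sum_mono2 finite_PiE prod_nonneg) (auto simp: J_def E_def)
      also have "\<dots> = (\<Prod>b\<in>B. \<Sum>j\<in>J b. E j)"
        using B(2) F(2) by (intro prod_sum_PiE[symmetric]) (auto simp: J_def)
      also have "\<dots> \<le> (\<Prod>b\<in>B. S)"
        unfolding S_def using F(2)
        by (intro prod_mono conjI sum_nonneg finite_sum_le_infsum E) (auto simp: J_def E_def)
      finally show "(\<Sum>x\<in>F. exp (- a * (norm x)\<^sup>2 + c * norm x)) \<le> exp D * S ^ card B"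
        by simp
    qed
  qed simp
qed

text \<open>Each \<open>x\<close> is an integer combination of a maximal independent subset
  \<open>B\<close> of \<open>G\<close> plus a remainder of bounded norm. Discreteness leaves
  finitely many remainders, and every step along \<open>B\<close> multiplies the bound on
  \<open>N\<close> by a fixed factor, while the number of steps is at most linear in
  \<open>norm x\<close>.\<close>

lemma submultiplicative_growth:
  fixes N :: "'a::euclidean_space \<Rightarrow> real"
  assumes G: "add_subgroup G" and discrete: "\<And>R. finite {x\<in>G. norm x \<le> R}"
    and nonneg: "\<And>x. x \<in> G \<Longrightarrow> 0 \<le> N x"
    and submult: "\<And>x y. x \<in> G \<Longrightarrow> y \<in> G \<Longrightarrow> N (x + y) \<le> N x * N y"
  obtains C c where "\<And>x. x \<in> G \<Longrightarrow> N x \<le> C * exp (c * norm x)"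
proof -
  obtain B where B: "B \<subseteq> G" "independent B" "G \<subseteq> span B"
    using maximal_independent_subset .
  have finB: "finite B" using B(2) by (rule independent_imp_finite)
  obtain K where K: "K \<ge> 0" "\<And>x b. x \<in> span B \<Longrightarrow> \<bar>representation B x b\<bar> \<le> K * norm x"
    using representation_bounded[OF B(2)] by blast
  \<comment> \<open>Dominating both \<open>N v\<close> and \<open>N (- v)\<close> allows steps in
    either direction; being at least 1 makes the powers of \<open>A v\<close> monotone in the
    exponent.\<close>
  define A where "A v = max 1 (max (N v) (N (- v)))" for v
  have A1: "A v \<ge> 1" "N v \<le> A v" "N (- v) \<le> A v" for v by (auto simp: A_def)
  have iter: "N (x + of_nat k *\<^sub>R w) \<le> N x * A v ^ k"
    if "x \<in> G" "w \<in> G" "N w \<le> A v" for x v w k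
  proof (induction k)
    case (Suc k)
    have "N (x + of_nat (Suc k) *\<^sub>R w) = N ((x + of_nat k *\<^sub>R w) + w)"
      by (simp add: algebra_simps)
    also have "\<dots> \<le> N (x + of_nat k *\<^sub>R w) * N w"
      using that by (intro submult add_subgroup_add G add_subgroup_of_nat_scaleR)
    also have "\<dots> \<le> (N x * A v ^ k) * A v"
      using Suc that nonneg A1(1)[of v] by (intro mult_mono) (auto intro!: mult_nonneg_nonneg)
    finally show ?case by (simp add: mult_ac)
  qed simp
  have step: "N (x + of_int k *\<^sub>R v) \<le> N x * A v ^ nat \<bar>k\<bar>"
    if "x \<in> G" "v \<in> G" for x v k
  proof (cases k rule: int_cases2)
    case (nonneg n)
    then show ?thesis using iter[of x v v n] that A1 by simp
  next
    case (nonpos n)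
    then show ?thesis using iter[of x "- v" v n] that A1 add_subgroup_minus[OF G] by simp
  qed
  have steps: "N (x + (\<Sum>v\<in>B'. of_int (k v) *\<^sub>R v)) \<le> N x * (\<Prod>v\<in>B'. A v ^ nat \<bar>k v\<bar>)"
    if "finite B'" "B' \<subseteq> B" "x \<in> G" for B' x k
    using that
  proof (induction B' rule: finite_induct)
    case (insert v B')
    have "N (x + (\<Sum>v\<in>insert v B'. of_int (k v) *\<^sub>R v))
        = N ((x + (\<Sum>v\<in>B'. of_int (k v) *\<^sub>R v)) + of_int (k v) *\<^sub>R v)"
      using insert by (simp add: add_ac)
    also have "\<dots> \<le> N (x + (\<Sum>v\<in>B'. of_int (k v) *\<^sub>R v)) * A v ^ nat \<bar>k v\<bar>"
      using insert B(1) by (intro step add_subgroup_add add_subgroup_sum add_subgroup_of_int_scaleR G) auto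
    also have "\<dots> \<le> (N x * (\<Prod>v\<in>B'. A v ^ nat \<bar>k v\<bar>)) * A v ^ nat \<bar>k v\<bar>"
      using insert A1(1)[of v] by (intro mult_right_mono) auto
    finally show ?case using insert by (simp add: mult_ac)
  qed simp
  \<comment> \<open>A bound for the remainders, whose norm is at most the sum of the basis norms;
    the inserted 0 gives a nonempty set and \<open>0 \<le> M\<close>.\<close>
  define M where "M = Max (insert 0 (N ` {x\<in>G. norm x \<le> (\<Sum>v\<in>B. norm v)}))"
  have M: "N x \<le> M" if "x \<in> G" "norm x \<le> (\<Sum>v\<in>B. norm v)" for x
    unfolding M_def using that discrete by (intro Max_ge) auto
  have M0: "0 \<le> M" unfolding M_def using discrete by (intro Max_ge) auto
  define P where "P = (\<Prod>v\<in>B. A v)"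
  \<comment> \<open>The steps along \<open>v\<close> are bounded by \<open>A v\<close> to the power
    \<open>K * norm x + 1\<close>: the 1, which accounts for rounding, goes into \<open>P\<close>
    and the rest into \<open>c\<close>.\<close>
  define c where "c = (\<Sum>v\<in>B. K * ln (A v))"
  show thesis
  proof (rule that[of "M * P" c])
    fix x assume x: "x \<in> G"
    define r where "r = representation B x"
    define y where "y = x - (\<Sum>v\<in>B. of_int \<lfloor>r v\<rfloor> *\<^sub>R v)"
    have y: "y \<in> G" unfolding y_def using x B(1)
      by (intro add_subgroup_diff add_subgroup_sum add_subgroup_of_int_scaleR G) auto
    have "x = (\<Sum>v\<in>B. r v *\<^sub>R v)"
      unfolding r_def using sum_representation_eq[of B x B] B finB x by auto
    then have "y = (\<Sum>v\<in>B. frac (r v) *\<^sub>R v)"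
      unfolding y_def frac_def by (simp add: sum_subtractf scaleR_left_diff_distrib)
    then have "norm y \<le> (\<Sum>v\<in>B. norm (frac (r v) *\<^sub>R v))" by (simp only: norm_sum)
    also have "\<dots> \<le> (\<Sum>v\<in>B. norm v)"
    proof (rule sum_mono)
      fix v
      have "0 \<le> frac (r v)" "frac (r v) \<le> 1" using frac_lt_1[of "r v"] by auto
      then show "norm (frac (r v) *\<^sub>R v) \<le> norm v" by (simp add: mult_left_le_one_le)
    qed
    finally have Ny: "N y \<le> M" using M y by simp
    have "N x = N (y + (\<Sum>v\<in>B. of_int \<lfloor>r v\<rfloor> *\<^sub>R v))" by (simp add: y_def)
    also have "\<dots> \<le> N y * (\<Prod>v\<in>B. A v ^ nat \<bar>\<lfloor>r v\<rfloor>\<bar>)"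
      using finB y by (intro steps) auto
    also have "\<dots> \<le> M * (\<Prod>v\<in>B. A v * exp (K * ln (A v) * norm x))"
    proof (intro mult_mono Ny M0 prod_mono conjI prod_nonneg)
      fix v
      have "real (nat \<bar>\<lfloor>r v\<rfloor>\<bar>) \<le> \<bar>r v\<bar> + 1" by linarith
      also have "\<dots> \<le> K * norm x + 1" using K(2)[of x v] x B(3) by (auto simp: r_def)
      finally have "A v powr (real (nat \<bar>\<lfloor>r v\<rfloor>\<bar>)) \<le> A v powr (K * norm x + 1)"
        using A1(1)[of v] by (intro powr_mono) auto
      also have "\<dots> = A v * exp (K * ln (A v) * norm x)"
        using A1(1)[of v] by (simp add: powr_def exp_add algebra_simps)
      finally show "A v ^ nat \<bar>\<lfloor>r v\<rfloor>\<bar> \<le> A v * exp (K * ln (A v) * norm x)"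
        by (subst (asm) powr_realpow) (use A1(1)[of v] in auto)
      show "0 \<le> A v ^ nat \<bar>\<lfloor>r v\<rfloor>\<bar>" "0 \<le> A v ^ nat \<bar>\<lfloor>r v\<rfloor>\<bar>" using A1(1)[of v] by auto
    qed
    also have "\<dots> = M * P * exp (c * norm x)"
      using finB by (simp add: P_def c_def prod.distrib exp_sum sum_distrib_right)
    finally show "N x \<le> M * P * exp (c * norm x)" .
  qed
qed

section \<open>Lattice automorphisms\<close>

lemma linear_funpow:
  fixes g :: "'a::real_vector \<Rightarrow> 'a"
  assumes "linear g"
  shows "linear (g ^^ k)"
proof (induction k)
  case (Suc k)
  then show ?case using linear_compose[OF Suc assms] by (simp add: o_def)
qed (simp add: linear_id[unfolded id_def] id_def)

text \<open>\<open>g\<close> maps the finite set of lattice vectors of bounded norm into itself. By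
  the pigeonhole principle two powers agree on it, hence on a basis and everywhere; injectivity
  cancels the smaller power.\<close>

lemma lattice_Aut_finite_order:
  assumes L: "full_lattice L" and g: "g \<in> lattice_Aut L"
  obtains n where "n > 0" "g ^^ n = id"
proof -
  obtain B where B: "independent B" "finite B" "span B = UNIV" "B \<subseteq> L"
    by (rule full_lattice_coordinates[OF L], rule that)
  have orth: "orthogonal_transformation g" and gL: "g ` L = L"
    using g by (auto simp: lattice_Aut_def)
  \<comment> \<open>The radius is large enough for the ball to contain the basis
    \<open>B\<close>.\<close>
  define S where "S = {x\<in>L. norm x \<le> (\<Sum>b\<in>B. norm b)}"
  have finS: "finite S" unfolding S_def using full_lattice_finite_ball[OF L] .
  have BS: "B \<subseteq> S"
    using B by (auto simp: S_def intro!: member_le_sum)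
  have iter: "(g ^^ k) x \<in> S" if "x \<in> S" for k x
    using that gL orth by (induction k) (auto simp: S_def orthogonal_transformation_norm)
  have lin: "linear (g ^^ k)" for k
    by (rule linear_funpow[OF orthogonal_transformation_linear[OF orth]])
  have "\<not> inj (\<lambda>k. restrict (g ^^ k) S)"
  proof
    assume "inj (\<lambda>k. restrict (g ^^ k) S)"
    moreover have "range (\<lambda>k. restrict (g ^^ k) S) \<subseteq> PiE S (\<lambda>_. S)" using iter by auto
    then have "finite (range (\<lambda>k. restrict (g ^^ k) S))"
      using finS finite_PiE finite_subset by metis
    ultimately show False using finite_imageD infinite_UNIV_nat by blast
  qed
  then obtain a b where ab: "a \<noteq> b" "restrict (g ^^ a) S = restrict (g ^^ b) S"
    unfolding inj_def by blast
  define i j where "i = min a b" and "j = max a b"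
  have ij: "i < j" "restrict (g ^^ i) S = restrict (g ^^ j) S"
    using ab by (cases "a < b"; simp add: i_def j_def min_def max_def)+
  have "(g ^^ i) x = (g ^^ j) x" for x
  proof (rule linear_eq_on_span[OF lin lin])
    show "x \<in> span B" using B(3) by simp
    fix b assume "b \<in> B"
    then show "(g ^^ i) b = (g ^^ j) b" using fun_cong[OF ij(2), of b] BS by auto
  qed
  moreover have "g ^^ j = (g ^^ i) \<circ> (g ^^ (j - i))" using ij(1) by (simp flip: funpow_add)
  moreover have "inj (g ^^ i)"
    using orthogonal_transformation_inj[OF orth] by (rule inj_fn)
  ultimately have "g ^^ (j - i) = id" by (auto simp: fun_eq_iff inj_eq)
  then show thesis using that[of "j - i"] ij(1) by simp
qed

lemma lattice_Aut_fun_order: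
  assumes "full_lattice L" "g \<in> lattice_Aut L"
  shows "fun_order g > 0" "g ^^ fun_order g = id"
proof -
  have "\<exists>n. 0 < n \<and> g ^^ n = id" using lattice_Aut_finite_order[OF assms] by blast
  then have *: "0 < fun_order g \<and> g ^^ fun_order g = id"
    unfolding fun_order_def by (rule LeastI_ex)
  show "fun_order g > 0" using * by (rule conjunct1)
  show "g ^^ fun_order g = id" using * by (rule conjunct2)
qed

section \<open>The projection onto the fixed space as an orbit average\<close>

locale lattice_isometry =
  fixes L :: "(real ^ 'n) set" and g :: "real ^ 'n \<Rightarrow> real ^ 'n"
  assumes lattice: "full_lattice L" and aut: "g \<in> lattice_Aut L"
begin

lemma orth: "orthogonal_transformation g"
  using aut by (simp add: lattice_Aut_def)

lemma linear_g: "linear g"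
  using orth by (rule orthogonal_transformation_linear)

lemma L_subgroup: "add_subgroup L"
  using full_lattice_add_subgroup[OF lattice] .

lemma g_lattice: "x \<in> L \<Longrightarrow> g x \<in> L"
  using aut imageI[of x L g] by (simp add: lattice_Aut_def)

lemma g_inner [simp]: "g x \<bullet> g y = x \<bullet> y"
  using orth by (simp add: orthogonal_transformation_def)

lemma g_norm [simp]: "norm (g x) = norm x"
  using orth by (rule orthogonal_transformation_norm)

abbreviation n :: nat where "n \<equiv> fun_order g"

lemma n_pos: "n > 0" and g_pow_n: "g ^^ n = id"
  by (rule lattice_Aut_fun_order[OF lattice aut])+

lemma linear_g_pow: "linear (g ^^ k)"
  using linear_g by (rule linear_funpow)

lemma g_pow_inner [simp]: "(g ^^ k) x \<bullet> (g ^^ k) y = x \<bullet> y"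
  by (induction k) auto

lemma g_pow_lattice: "x \<in> L \<Longrightarrow> (g ^^ k) x \<in> L"
  by (induction k) (auto intro: g_lattice)

lemma g_pow_fixed: "g u = u \<Longrightarrow> (g ^^ k) u = u"
  by (induction k) auto

lemma sum_orbit_fixed: "g (\<Sum>k<n. (g ^^ k) x) = (\<Sum>k<n. (g ^^ k) x)"
proof -
  have "g (\<Sum>k<n. (g ^^ k) x) = (\<Sum>k<n. (g ^^ Suc k) x)"
    by (simp add: linear_sum[OF linear_g])
  also have "\<dots> = (\<Sum>k<n. (g ^^ k) x)"
    using sum.lessThan_Suc_shift[of "\<lambda>k. (g ^^ k) x" n] g_pow_n by simp
  finally show ?thesis .
qed

text \<open>The orbit average is fixed, and \<open>x\<close> minus it is orthogonal to every fixed
  vector because all \<open>(g ^^ k) x\<close> have the same inner product with such a vector. Two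
  candidates differ by a fixed vector orthogonal to itself.\<close>

lemma fix_proj_eq: "fix_proj g x = (1 / n) *\<^sub>R (\<Sum>k<n. (g ^^ k) x)"
  unfolding fix_proj_def
proof (rule the_equality)
  let ?p = "(1 / n) *\<^sub>R (\<Sum>k<n. (g ^^ k) x)"
  have fix_p: "g ?p = ?p" by (simp add: linear_cmul[OF linear_g] sum_orbit_fixed)
  have perp: "(x - ?p) \<bullet> u = 0" if "g u = u" for u
  proof -
    have "(g ^^ k) x \<bullet> u = x \<bullet> u" for k
      using g_pow_inner[of k x u] g_pow_fixed[OF that, of k] by simp
    then show ?thesis using n_pos by (simp add: inner_diff_left inner_sum_left)
  qed
  show "g ?p = ?p \<and> (\<forall>u. g u = u \<longrightarrow> (x - ?p) \<bullet> u = 0)" using fix_p perp by blast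
  fix p assume p: "g p = p \<and> (\<forall>u. g u = u \<longrightarrow> (x - p) \<bullet> u = 0)"
  have "g (p - ?p) = p - ?p" using p fix_p linear_diff[OF linear_g] by simp
  then have "(x - ?p) \<bullet> (p - ?p) = 0" "(x - p) \<bullet> (p - ?p) = 0" using p perp by blast+
  then have "(p - ?p) \<bullet> (p - ?p) = 0" by (simp add: inner_diff_left)
  then show "p = ?p" by (simp only: inner_eq_zero_iff right_minus_eq)
qed

lemma linear_fix_proj: "linear (fix_proj g)"
proof (rule linearI)
  show "fix_proj g (x + y) = fix_proj g x + fix_proj g y" for x y
    unfolding fix_proj_eq linear_add[OF linear_g_pow] sum.distrib scaleR_right_distrib ..
  show "fix_proj g (c *\<^sub>R x) = c *\<^sub>R fix_proj g x" for c x
    unfolding fix_proj_eq linear_cmul[OF linear_g_pow] scaleR_sum_right[symmetric]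
    by (rule scaleR_left_commute)
qed

lemma fix_proj_fixed: "g (fix_proj g x) = fix_proj g x"
  by (simp add: fix_proj_eq linear_cmul[OF linear_g] sum_orbit_fixed)

text \<open>The multiple is the orbit sum. Scaling by \<open>n\<close> thus embeds the projected
  lattice into \<open>L\<close>, and finiteness and summability can be pulled back from
  \<open>L\<close>.\<close>

lemma fix_proj_mult_lattice:
  assumes "x \<in> L"
  shows "of_nat n *\<^sub>R fix_proj g x \<in> L"
proof -
  have "of_nat n *\<^sub>R fix_proj g x = (\<Sum>k<n. (g ^^ k) x)"
    using n_pos by (simp add: fix_proj_eq)
  then show ?thesis using assms by (simp add: add_subgroup_sum L_subgroup g_pow_lattice)
qed

lemma fix_proj_commute:
  assumes "linear h" "g \<circ> h = h \<circ> g"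
  shows "fix_proj g (h x) = h (fix_proj g x)"
proof -
  have "(g ^^ k) (h x) = h ((g ^^ k) x)" for k
  proof (induction k)
    case (Suc k)
    then show ?case using fun_cong[OF assms(2), of "(g ^^ k) x"] by simp
  qed simp
  then show ?thesis
    by (simp add: fix_proj_eq linear_cmul[OF assms(1)] linear_sum[OF assms(1)])
qed

lemma finite_fix_proj_ball: "finite {\<beta>\<in>fix_proj g ` L. norm \<beta> \<le> R}"
proof (rule finite_imageD)
  have "(\<lambda>\<beta>. real n *\<^sub>R \<beta>) ` {\<beta>\<in>fix_proj g ` L. norm \<beta> \<le> R} \<subseteq> {x\<in>L. norm x \<le> n * R}"
    using fix_proj_mult_lattice by (auto intro!: mult_left_mono)
  then show "finite ((\<lambda>\<beta>. real n *\<^sub>R \<beta>) ` {\<beta>\<in>fix_proj g ` L. norm \<beta> \<le> R})"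
    using full_lattice_finite_ball[OF lattice] by (rule finite_subset)
  show "inj_on (\<lambda>\<beta>. real n *\<^sub>R \<beta>) {\<beta>\<in>fix_proj g ` L. norm \<beta> \<le> R}"
    using n_pos by (auto simp: inj_on_def)
qed

lemma fix_proj_gaussian_summable:
  assumes "a > 0"
  shows "(\<lambda>\<beta>. exp (- a * (norm \<beta>)\<^sup>2 + c * norm \<beta>)) summable_on fix_proj g ` L"
proof -
  \<comment> \<open>The constants are rescaled so that substituting \<open>n\<close> times
    \<open>\<beta>\<close> gives back \<open>a\<close> and \<open>c\<close>.\<close>
  let ?f = "\<lambda>x. exp (- (a / (real n)\<^sup>2) * (norm x)\<^sup>2 + (c / n) * norm x)"
  let ?m = "\<lambda>\<beta>. real n *\<^sub>R \<beta>"
  have "?f summable_on L"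
    using assms n_pos by (intro full_lattice_gaussian_summable lattice) simp
  then have "?f summable_on ?m ` fix_proj g ` L"
    by (rule summable_on_subset_banach) (use fix_proj_mult_lattice in auto)
  then have "(?f \<circ> ?m) summable_on fix_proj g ` L"
    using n_pos by (subst (asm) summable_on_reindex) (auto simp: inj_on_def)
  moreover have "?f \<circ> ?m = (\<lambda>\<beta>. exp (- a * (norm \<beta>)\<^sup>2 + c * norm \<beta>))"
    using n_pos by (intro ext) (simp add: power_mult_distrib)
  ultimately show ?thesis by (rule back_subst[of "\<lambda>f. f summable_on fix_proj g ` L"])
qed

end

section \<open>The factor \<open>B\<close> on an integral lattice\<close>

lemma ip_add:
  assumes "\<alpha> \<bullet> \<gamma> \<in> \<int>"
  shows "ip (\<alpha> + \<beta>) \<gamma> = ip \<alpha> \<gamma> + ip \<beta> \<gamma>"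
proof -
  obtain k where "\<alpha> \<bullet> \<gamma> = of_int k" using assms Ints_cases by blast
  then show "ip (\<alpha> + \<beta>) \<gamma> = ip \<alpha> \<gamma> + ip \<beta> \<gamma>"
    by (simp add: ip_def inner_add_left)
qed

locale integral_lattice_isometry = lattice_isometry L g
  for L :: "(real ^ 'n) set" and g +
  fixes \<xi> :: complex
  assumes integral: "x \<in> L \<Longrightarrow> y \<in> L \<Longrightarrow> x \<bullet> y \<in> \<int>"
    and root: "primitive_root_of_unity n \<xi>"
begin

lemma one_minus_root_power: "k \<in> {1..<n} \<Longrightarrow> 1 - \<xi> ^ k \<noteq> 0"
  using root by (auto simp: primitive_root_of_unity_def)

lemma bfactor_nonzero: "bfactor \<xi> g \<alpha> \<beta> \<noteq> 0"
  using n_pos one_minus_root_power by (auto simp: bfactor_def power_int_eq_0_iff)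

lemma bfactor_add_left:
  assumes "\<alpha> \<in> L" "\<beta> \<in> L" "\<gamma> \<in> L"
  shows "bfactor \<xi> g (\<alpha> + \<beta>) \<gamma> = bfactor \<xi> g \<alpha> \<gamma> * bfactor \<xi> g \<beta> \<gamma>"
proof -
  have ip: "ip ((g ^^ k) (\<alpha> + \<beta>)) \<gamma> = ip ((g ^^ k) \<alpha>) \<gamma> + ip ((g ^^ k) \<beta>) \<gamma>" for k
    unfolding linear_add[OF linear_g_pow] by (intro ip_add integral g_pow_lattice assms)
  have "of_nat n powi (- ip (\<alpha> + \<beta>) \<gamma>) = of_nat n powi (- ip \<alpha> \<gamma>) * (of_nat n powi (- ip \<beta> \<gamma>) :: complex)"
    using ip[of 0] n_pos by (simp add: power_int_diff power_int_minus divide_inverse)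
  moreover have "(\<Prod>k = 1..<n. (1 - \<xi> ^ k) powi ip ((g ^^ k) (\<alpha> + \<beta>)) \<gamma>)
      = (\<Prod>k = 1..<n. (1 - \<xi> ^ k) powi ip ((g ^^ k) \<alpha>) \<gamma> * (1 - \<xi> ^ k) powi ip ((g ^^ k) \<beta>) \<gamma>)"
  proof (rule prod.cong[OF refl])
    fix k assume "k \<in> {1..<n}"
    then show "(1 - \<xi> ^ k) powi ip ((g ^^ k) (\<alpha> + \<beta>)) \<gamma>
        = (1 - \<xi> ^ k) powi ip ((g ^^ k) \<alpha>) \<gamma> * (1 - \<xi> ^ k) powi ip ((g ^^ k) \<beta>) \<gamma>"
      unfolding ip using one_minus_root_power by (intro power_int_add) blast
  qed
  ultimately show ?thesis by (simp only: bfactor_def prod.distrib mult_ac)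
qed

text \<open>Replacing \<open>k\<close> by \<open>n - k\<close> interchanges the arguments, since
  \<open>g ^^ (n - k)\<close> is the adjoint of \<open>g ^^ k\<close>. It also turns
  \<open>\<xi> ^ k\<close> into its inverse, which preserves \<open>norm (1 - \<xi> ^ k)\<close>
  because \<open>\<xi>\<close> has absolute value 1.\<close>

lemma norm_bfactor_commute:
  assumes "\<alpha> \<in> L" "\<beta> \<in> L"
  shows "norm (bfactor \<xi> g \<beta> \<alpha>) = norm (bfactor \<xi> g \<alpha> \<beta>)"
proof -
  have "norm \<xi> ^ n = 1 ^ n"
    using root by (simp add: primitive_root_of_unity_def flip: norm_power)
  then have norm1: "norm \<xi> = 1"
    using n_pos by (intro power_eq_imp_eq_base[of "norm \<xi>" n 1]) auto
  have norm_conj: "norm (1 - \<xi> ^ (n - k)) = norm (1 - \<xi> ^ k)" if "k \<in> {1..<n}" for k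
  proof -
    have "\<xi> ^ (n - k) * \<xi> ^ k = 1"
      using that root by (simp add: primitive_root_of_unity_def flip: power_add)
    then have "1 - \<xi> ^ (n - k) = \<xi> ^ (n - k) * (\<xi> ^ k - 1)" by (simp add: algebra_simps)
    then show ?thesis by (simp add: norm_mult norm_power norm1 norm_minus_commute)
  qed
  have ip_swap: "ip ((g ^^ k) \<beta>) \<alpha> = ip ((g ^^ (n - k)) \<alpha>) \<beta>" if "k \<in> {1..<n}" for k
  proof -
    have "(g ^^ k) ((g ^^ (n - k)) \<alpha>) = \<alpha>"
      using that g_pow_n fun_cong[OF funpow_add[of k "n - k" g], of \<alpha>] by simp
    then show ?thesis
      using g_pow_inner[of k \<beta> "(g ^^ (n - k)) \<alpha>"] by (simp add: ip_def inner_commute)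
  qed
  have "(\<Prod>k = 1..<n. norm (1 - \<xi> ^ k) powi ip ((g ^^ k) \<beta>) \<alpha>)
      = (\<Prod>k = 1..<n. norm (1 - \<xi> ^ (n - k)) powi ip ((g ^^ (n - k)) \<alpha>) \<beta>)"
    using ip_swap norm_conj by (intro prod.cong) auto
  also have "\<dots> = (\<Prod>k = 1..<n. norm (1 - \<xi> ^ k) powi ip ((g ^^ k) \<alpha>) \<beta>)"
    by (rule prod.reindex_bij_witness[of _ "\<lambda>k. n - k" "\<lambda>k. n - k"]) auto
  finally show ?thesis
    by (simp add: bfactor_def norm_mult norm_power_int ip_def inner_commute flip: prod_norm)
qed

lemma norm_bfactor_add_right:
  assumes "\<alpha> \<in> L" "\<beta> \<in> L" "\<gamma> \<in> L"
  shows "norm (bfactor \<xi> g \<gamma> (\<alpha> + \<beta>)) = norm (bfactor \<xi> g \<gamma> \<alpha>) * norm (bfactor \<xi> g \<gamma> \<beta>)"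
  using assms norm_bfactor_commute bfactor_add_left add_subgroup_add[OF L_subgroup]
  by (metis norm_mult)

lemma bfactor_invariant:
  assumes "orthogonal_transformation h" "g \<circ> h = h \<circ> g"
  shows "bfactor \<xi> g (h \<alpha>) (h \<beta>) = bfactor \<xi> g \<alpha> \<beta>"
proof -
  have "(g ^^ k) (h \<alpha>) = h ((g ^^ k) \<alpha>)" for k
  proof (induction k)
    case (Suc k)
    then show ?case using fun_cong[OF assms(2), of "(g ^^ k) \<alpha>"] by simp
  qed simp
  then show ?thesis
    using assms(1) by (simp add: bfactor_def ip_def orthogonal_transformation_def)
qed

end

section \<open>Complexification of real isometries and of the bilinear form\<close>

lemma cform_cvec:
  "cform v (cvec x) = Complex ((\<chi> i. Re (v $ i)) \<bullet> x) ((\<chi> i. Im (v $ i)) \<bullet> x)"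
  by (simp add: complex_eq_iff cform_def cvec_def inner_vec_def)

lemma cform_cvec_real: "cform (cvec y) (cvec x) = of_real (y \<bullet> x)"
  by (simp add: cform_def cvec_def inner_vec_def)

lemma Re_cmap: "(\<chi> i. Re (cmap g v $ i)) = g (\<chi> i. Re (v $ i))"
  and Im_cmap: "(\<chi> i. Im (cmap g v $ i)) = g (\<chi> i. Im (v $ i))"
  by (simp_all add: vec_eq_iff cmap_def cvec_def)

lemma cmap_eqI:
  "g (\<chi> i. Re (v $ i)) = (\<chi> i. Re (w $ i)) \<Longrightarrow> g (\<chi> i. Im (v $ i)) = (\<chi> i. Im (w $ i)) \<Longrightarrow> cmap g v = w"
  by (simp add: vec_eq_iff complex_eq_iff cmap_def cvec_def)

lemma cmap_compose: "cmap f (cmap g v) = cmap (f \<circ> g) v"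
  by (rule cmap_eqI) (simp_all add: Re_cmap Im_cmap)

lemma cmap_id: "cmap id v = v"
  by (rule cmap_eqI) simp_all

lemma cmap_cvec_fixed: "g x = x \<Longrightarrow> linear g \<Longrightarrow> cmap g (cvec x) = cvec x"
  by (rule cmap_eqI) (simp_all add: cvec_def linear_0 flip: zero_vec_def)

lemma cform_cmap_orthogonal:
  "orthogonal_transformation h \<Longrightarrow> cform (cmap h v) (cvec (h x)) = cform v (cvec x)"
  by (simp add: cform_cvec Re_cmap Im_cmap orthogonal_transformation_def)

section \<open>The vacuum space of a twisted module\<close>

text \<open>Collects the facts about the twisted module and the lift of \<open>h\<close> on which
  the trace computation rests: the modes are linear, \<open>\<phi>\<close> intertwines, and
  \<open>hhat\<close> acts on the generators in the given way. The action of \<open>\<phi>\<close>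
  on \<open>U \<alpha> w\<close> is not assumed but derived from these and
  \<open>U_leading\<close>.\<close>

locale twisted_vacuum =
  integral_lattice_isometry L g \<xi> + vacuum_operators L \<epsilon> g \<xi> cur ex scW Y U +
  complex_vector_space scW
  for L :: "(real ^ 'n) set" and g \<xi> \<epsilon>
    and cur :: "complex ^ 'n \<Rightarrow> 'v"
    and ex scW
    and Y :: "'v \<Rightarrow> real \<Rightarrow> 'w \<Rightarrow> 'w::ab_group_add"
    and U +
  fixes sc :: "complex \<Rightarrow> 'v \<Rightarrow> 'v"
    and h :: "real ^ 'n \<Rightarrow> real ^ 'n" and hhat :: "'v \<Rightarrow> 'v" and \<eta> :: "real ^ 'n \<Rightarrow> complex"
    and \<phi> :: "'w \<Rightarrow> 'w"
  assumes Y_linear: "Vector_Spaces.linear scW scW (Y a r)"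
    and Y_scale_left: "Y (sc c a) r w = scW c (Y a r w)"
    and cocycle: "lattice_cocycle L \<epsilon>"
    and h_aut: "h \<in> lattice_Aut L"
    and commute: "g \<circ> h = h \<circ> g"
    and \<eta>_nonzero: "\<alpha> \<in> L \<Longrightarrow> \<eta> \<alpha> \<noteq> 0"
    and \<eta>_mult: "\<alpha> \<in> L \<Longrightarrow> \<beta> \<in> L \<Longrightarrow> \<eta> \<alpha> * \<eta> \<beta> * \<epsilon> \<alpha> \<beta> = \<eta> (\<alpha> + \<beta>) * \<epsilon> (h \<alpha>) (h \<beta>)"
    and hhat_cur: "hhat (cur v) = cur (cmap h v)"
    and hhat_ex: "\<alpha> \<in> L \<Longrightarrow> hhat (ex \<alpha>) = sc (inverse (\<eta> \<alpha>)) (ex (h \<alpha>))"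
    and \<phi>_linear: "Vector_Spaces.linear scW scW \<phi>"
    and \<phi>_Y: "\<phi> (Y a r w) = Y (hhat a) r (\<phi> w)"
begin

abbreviation \<pi> :: "real ^ 'n \<Rightarrow> real ^ 'n" where "\<pi> \<equiv> fix_proj g"
abbreviation \<Omega> :: "'w set" where "\<Omega> \<equiv> vacuum_space cur Y"
abbreviation \<Omega>_wt :: "real ^ 'n \<Rightarrow> 'w set" where "\<Omega>_wt \<equiv> weight_space cur scW Y g"

sublocale h: lattice_isometry L h
  using lattice h_aut by unfold_locales

lemma Y_add: "Y a r (w + w') = Y a r w + Y a r w'"
  and Y_scale: "Y a r (scW c w) = scW c (Y a r w)"
proof -
  interpret Vector_Spaces.linear scW scW "Y a r" by (rule Y_linear)
  show "Y a r (w + w') = Y a r w + Y a r w'" by (rule add)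
  show "Y a r (scW c w) = scW c (Y a r w)" by (rule scale)
qed

lemma Y_zero: "Y a r 0 = 0"
  using Y_scale[of a r 0 0] by simp

lemma \<phi>_add: "\<phi> (w + w') = \<phi> w + \<phi> w'"
  and \<phi>_scale: "\<phi> (scW c w) = scW c (\<phi> w)"
proof -
  interpret Vector_Spaces.linear scW scW \<phi> by (rule \<phi>_linear)
  show "\<phi> (w + w') = \<phi> w + \<phi> w'" by (rule add)
  show "\<phi> (scW c w) = scW c (\<phi> w)" by (rule scale)
qed

lemma \<phi>_zero: "\<phi> 0 = 0"
  using \<phi>_scale[of 0 0] by simp

lemma lin_on_\<phi>: "lin_on S \<phi>"
  by (simp add: lin_on_def \<phi>_add \<phi>_scale)

lemma vacuum_subspace: "subspace \<Omega>"
  by (rule subspaceI) (auto simp: vacuum_space_def Y_add Y_scale Y_zero)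

lemma weight_vacuum: "w \<in> \<Omega>_wt \<beta> \<Longrightarrow> w \<in> \<Omega>"
  by (simp add: weight_space_def)

lemma weight_subspace: "subspace (\<Omega>_wt \<beta>)"
  by (rule subspaceI)
    (auto simp: weight_space_def Y_add Y_scale Y_zero scale_right_distrib scale_left_commute
      intro: subspace_0 subspace_add subspace_scale vacuum_subspace)

section \<open>Compatibility of the weights and of the map \<open>\<phi>\<close> with
  \<open>h\<close>\<close>

lemma \<pi>_h: "\<pi> (h x) = h (\<pi> x)"
  using h.linear_g commute by (rule fix_proj_commute)

lemma \<pi>_zero_mem: "0 \<in> \<pi> ` L"
  using linear_0[OF linear_fix_proj] add_subgroup_zero[OF L_subgroup] by (metis imageI)

lemma \<pi>_image_fixed: "\<beta> \<in> \<pi> ` L \<Longrightarrow> g \<beta> = \<beta>"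
  using fix_proj_fixed by blast

lemma h_inverse: "h \<circ> inv h = id" "g \<circ> inv h = inv h \<circ> g"
proof -
  have bij: "bij h" using h.orth by (rule orthogonal_transformation_bij)
  show "h \<circ> inv h = id" by (rule surj_iff[THEN iffD1, OF bij_is_surj[OF bij]])
  show "g \<circ> inv h = inv h \<circ> g"
  proof
    fix x
    have "g x = h (g (inv h x))"
      using fun_cong[OF commute, of "inv h x"] surj_f_inv_f[OF bij_is_surj[OF bij], of x] by simp
    then show "(g \<circ> inv h) x = (inv h \<circ> g) x" by (simp add: inv_f_f[OF bij_is_inj[OF bij]])
  qed
qed

lemma cmap_h_inverse: "cmap h (cmap (inv h) v) = v"
  by (simp only: cmap_compose h_inverse cmap_id)

text \<open>As \<open>h\<close> is invertible, every \<open>cur v\<close> is \<open>hhat\<close> of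
  some \<open>cur u\<close>, and a mode of \<open>cur v\<close> on \<open>\<phi> w\<close> is
  \<open>\<phi>\<close> applied to the same mode of \<open>cur u\<close> on
  \<open>w\<close>.\<close>

lemma \<phi>_vacuum:
  assumes "w \<in> \<Omega>"
  shows "\<phi> w \<in> \<Omega>"
  unfolding vacuum_space_def
proof (intro CollectI allI impI)
  fix v and m :: real assume "0 < m"
  then have "Y (cur (cmap (inv h) v)) m w = 0" using assms by (simp add: vacuum_space_def)
  then show "Y (cur v) m (\<phi> w) = 0"
    using \<phi>_Y[of "cur (cmap (inv h) v)" m w] by (simp add: hhat_cur cmap_h_inverse \<phi>_zero)
qed

lemma \<phi>_weight:
  assumes "w \<in> \<Omega>_wt \<beta>"
  shows "\<phi> w \<in> \<Omega>_wt (h \<beta>)"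
  unfolding weight_space_def
proof (intro CollectI conjI allI impI)
  show "\<phi> w \<in> \<Omega>" using assms by (intro \<phi>_vacuum weight_vacuum)
  fix v assume v: "cmap g v = v"
  \<comment> \<open>The zero mode of \<open>v\<close> on \<open>\<phi> w\<close> comes from that of
    \<open>u\<close> on \<open>w\<close>; \<open>u\<close> is again fixed by \<open>g\<close>
    because \<open>inv h\<close> commutes with \<open>g\<close>.\<close>
  define u where "u = cmap (inv h) v"
  have "cmap g u = cmap (inv h) (cmap g v)"
    by (simp only: u_def cmap_compose h_inverse)
  then have "cmap g u = u" by (simp add: v u_def)
  then have "Y (cur u) 0 w = scW (cform u (cvec \<beta>)) w"
    using assms by (simp add: weight_space_def)
  moreover have "cform v (cvec (h \<beta>)) = cform u (cvec \<beta>)"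
    using cform_cmap_orthogonal[OF h.orth, of u \<beta>] by (simp add: u_def cmap_h_inverse)
  ultimately show "Y (cur v) 0 (\<phi> w) = scW (cform v (cvec (h \<beta>))) (\<phi> w)"
    using \<phi>_Y[of "cur u" 0 w] by (simp add: hhat_cur u_def cmap_h_inverse \<phi>_scale)
qed

lemma \<phi>_weight_zero: "w \<in> \<Omega>_wt 0 \<Longrightarrow> \<phi> w \<in> \<Omega>_wt 0"
  using \<phi>_weight[of w 0] by (simp add: linear_0[OF h.linear_g])

text \<open>On weight 0, \<open>U \<alpha>\<close> is a mode of \<open>ex \<alpha>\<close> whose
  index depends only on the norms of \<open>\<alpha>\<close> and of its projection. These are
  invariant under \<open>h\<close>, so \<open>\<phi>\<close> carries it to the mode that gives
  \<open>U (h \<alpha>)\<close>, up to the scalar of the lift.\<close>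

lemma \<phi>_U:
  assumes \<alpha>: "\<alpha> \<in> L" and w: "w \<in> \<Omega>_wt 0"
  shows "\<phi> (U \<alpha> w) = scW (inverse (\<eta> \<alpha>)) (U (h \<alpha>) (\<phi> w))"
proof -
  have "\<pi> (h \<alpha>) \<bullet> \<pi> (h \<alpha>) - h \<alpha> \<bullet> h \<alpha> = \<pi> \<alpha> \<bullet> \<pi> \<alpha> - \<alpha> \<bullet> \<alpha>"
    by (simp add: \<pi>_h)
  then show ?thesis
    using U_leading[OF \<alpha> \<pi>_zero_mem w]
      U_leading[OF h.g_lattice[OF \<alpha>] \<pi>_zero_mem \<phi>_weight_zero[OF w]]
    by (simp add: \<phi>_Y hhat_ex[OF \<alpha>] Y_scale_left)
qed

section \<open>The blocks of \<open>\<phi>\<close> and their traces\<close>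

lemma cocycle_square: "\<alpha> \<in> L \<Longrightarrow> \<beta> \<in> L \<Longrightarrow> \<epsilon> \<alpha> \<beta> * \<epsilon> \<alpha> \<beta> = 1"
  and norm_cocycle: "\<alpha> \<in> L \<Longrightarrow> \<beta> \<in> L \<Longrightarrow> norm (\<epsilon> \<alpha> \<beta>) = 1"
  using cocycle by (fastforce simp: lattice_cocycle_def)+

text \<open>The coefficient of the trace in the summand for \<open>\<alpha>\<close>, apart from the
  power of \<open>q\<close>.\<close>

definition twist :: "real ^ 'n \<Rightarrow> complex" where
  "twist \<alpha> = inverse (\<eta> \<alpha>) * \<epsilon> \<alpha> (h \<alpha> - \<alpha>) * bfactor \<xi> g \<alpha> (h \<alpha> - \<alpha>)"

lemma twist_nonzero: "\<alpha> \<in> L \<Longrightarrow> twist \<alpha> \<noteq> 0"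
  using \<eta>_nonzero norm_cocycle[of \<alpha> "h \<alpha> - \<alpha>"] bfactor_nonzero
    add_subgroup_diff[OF L_subgroup h.g_lattice]
  by (auto simp: twist_def)

text \<open>This is the operator \<open>X\<^sub>\<alpha>\<close> of the introduction.\<close>

definition block_op :: "real ^ 'n \<Rightarrow> 'w \<Rightarrow> 'w" where
  "block_op \<alpha> w = scW (twist \<alpha>) (U (h \<alpha> - \<alpha>) w)"

lemma h_diff_lattice: "\<alpha> \<in> L \<Longrightarrow> h \<alpha> - \<alpha> \<in> L"
  by (intro add_subgroup_diff[OF L_subgroup] h.g_lattice)

text \<open>The product rule writes \<open>U (h \<alpha>)\<close> as a multiple of
  \<open>U \<alpha>\<close> after \<open>U (h \<alpha> - \<alpha>)\<close>. Solving for it inverts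
  the scalar: \<open>\<epsilon>\<close> is its own inverse, and \<open>bfactor\<close> enters
  uninverted.\<close>

lemma \<phi>_U_block:
  assumes \<alpha>: "\<alpha> \<in> L" and w: "w \<in> \<Omega>_wt 0"
  shows "\<phi> (U \<alpha> w) = scW (twist \<alpha>) (U \<alpha> (U (h \<alpha> - \<alpha>) (\<phi> w)))"
proof -
  have "\<phi> w \<in> \<Omega>" using w by (intro \<phi>_vacuum weight_vacuum)
  then have "U \<alpha> (U (h \<alpha> - \<alpha>) (\<phi> w))
      = scW (\<epsilon> \<alpha> (h \<alpha> - \<alpha>) * inverse (bfactor \<xi> g \<alpha> (h \<alpha> - \<alpha>))) (U (h \<alpha>) (\<phi> w))"
    using U_mult[OF \<alpha> h_diff_lattice[OF \<alpha>]] by simp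
  moreover have "twist \<alpha> * (\<epsilon> \<alpha> (h \<alpha> - \<alpha>) * inverse (bfactor \<xi> g \<alpha> (h \<alpha> - \<alpha>))) = inverse (\<eta> \<alpha>)"
    using cocycle_square[OF \<alpha> h_diff_lattice[OF \<alpha>]] bfactor_nonzero[of \<alpha> "h \<alpha> - \<alpha>"]
    by (simp add: twist_def field_simps)
  ultimately show ?thesis by (simp add: \<phi>_U[OF assms])
qed

lemma lin_on_U: "\<alpha> \<in> L \<Longrightarrow> lin_on (\<Omega>_wt \<beta>) (U \<alpha>)"
  by (simp add: lin_on_def U_add U_scale weight_vacuum)

lemma U_weight_bij:
  assumes "\<alpha> \<in> L" "\<beta> \<in> \<pi> ` L"
  shows "bij_betw (U \<alpha>) (\<Omega>_wt \<beta>) (\<Omega>_wt (\<beta> + \<pi> \<alpha>))"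
  using U_weight[OF assms(2,1)] bij_betw_imp_inj_on[OF U_bij[OF assms(1)]] weight_vacuum
  by (auto simp: bij_betw_def intro: inj_on_subset)

lemma weight_zero_basis:
  obtains B where "independent B" "finite B" "span B = \<Omega>_wt 0"
proof -
  obtain F where F: "finite F" "span F = \<Omega>_wt 0" using weight_zero_finite by blast
  obtain B where B: "B \<subseteq> F" "independent B" "F \<subseteq> span B"
    using maximal_independent_subset .
  show thesis
    using that[OF B(2) finite_subset[OF B(1) F(1)]] F(2) B span_eq span_base by blast
qed

lemma weight_basis:
  assumes "\<beta> \<in> \<pi> ` L"
  obtains B where "independent B" "finite B" "span B = \<Omega>_wt \<beta>"
proof -
  obtain \<alpha> where \<alpha>: "\<alpha> \<in> L" "\<beta> = \<pi> \<alpha>" using assms by blast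
  obtain B where B: "independent B" "finite B" "span B = \<Omega>_wt 0" by (rule weight_zero_basis)
  have bij: "bij_betw (U \<alpha>) (\<Omega>_wt 0) (\<Omega>_wt \<beta>)"
    using U_weight_bij[OF \<alpha>(1) \<pi>_zero_mem] \<alpha>(2) by simp
  show thesis
    using that[of "U \<alpha> ` B"] basis_image(1,2)[OF B lin_on_U[OF \<alpha>(1)] bij] B(2) by blast
qed

text \<open>The difference \<open>h \<alpha> - \<alpha>\<close> projects to 0, so its operator does
  not shift weights.\<close>

lemma block_op_weight_zero:
  assumes "\<alpha> \<in> L" "\<pi> (h \<alpha>) = \<pi> \<alpha>"
  shows "U (h \<alpha> - \<alpha>) ` \<Omega>_wt 0 \<subseteq> \<Omega>_wt 0" "lin_on (\<Omega>_wt 0) (block_op \<alpha>)"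
    "block_op \<alpha> ` \<Omega>_wt 0 \<subseteq> \<Omega>_wt 0"
proof -
  show *: "U (h \<alpha> - \<alpha>) ` \<Omega>_wt 0 \<subseteq> \<Omega>_wt 0"
    using U_weight[OF \<pi>_zero_mem h_diff_lattice[OF assms(1)]] assms(2)
    by (simp add: linear_diff[OF linear_fix_proj])
  show "lin_on (\<Omega>_wt 0) (block_op \<alpha>)"
    using lin_on_U[OF h_diff_lattice[OF assms(1)], of 0]
    by (simp add: lin_on_def block_op_def scale_right_distrib scale_left_commute)
  show "block_op \<alpha> ` \<Omega>_wt 0 \<subseteq> \<Omega>_wt 0"
    using * by (auto simp: block_op_def intro!: subspace_scale[OF weight_subspace])
qed

text \<open>\<open>U \<alpha>\<close> identifies weight 0 with weight \<open>\<pi> \<alpha>\<close>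
  and conjugates \<open>\<phi>\<close> into \<open>block_op \<alpha>\<close> after
  \<open>\<phi>\<close>. The first form serves the norm estimate, the second the final
  formula.\<close>

lemma trace_weight:
  assumes \<alpha>: "\<alpha> \<in> L" "\<pi> (h \<alpha>) = \<pi> \<alpha>"
  shows "trace_on scW (\<Omega>_wt (\<pi> \<alpha>)) \<phi> = trace_on scW (\<Omega>_wt 0) (\<lambda>w. block_op \<alpha> (\<phi> w))"
    and "trace_on scW (\<Omega>_wt (\<pi> \<alpha>)) \<phi>
      = twist \<alpha> * trace_on scW (\<Omega>_wt 0) (\<lambda>w. U (h \<alpha> - \<alpha>) (\<phi> w))"
proof -
  obtain B where B: "independent B" "finite B" "span B = \<Omega>_wt 0" by (rule weight_zero_basis)
  have bij: "bij_betw (U \<alpha>) (\<Omega>_wt 0) (\<Omega>_wt (\<pi> \<alpha>))"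
    using U_weight_bij[OF \<alpha>(1) \<pi>_zero_mem] by simp
  note op = block_op_weight_zero[OF \<alpha>]
  have lin: "lin_on (\<Omega>_wt 0) (\<lambda>w. block_op \<alpha> (\<phi> w))" "lin_on (\<Omega>_wt 0) (\<lambda>w. U (h \<alpha> - \<alpha>) (\<phi> w))"
    using op(2) lin_on_U[OF h_diff_lattice[OF \<alpha>(1)], of 0] \<phi>_weight_zero
    by (simp_all add: lin_on_def \<phi>_add \<phi>_scale)
  have maps: "(\<lambda>w. block_op \<alpha> (\<phi> w)) ` \<Omega>_wt 0 \<subseteq> \<Omega>_wt 0"
    "(\<lambda>w. U (h \<alpha> - \<alpha>) (\<phi> w)) ` \<Omega>_wt 0 \<subseteq> \<Omega>_wt 0"
    using op(1,3) \<phi>_weight_zero by blast+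
  show 1: "trace_on scW (\<Omega>_wt (\<pi> \<alpha>)) \<phi> = trace_on scW (\<Omega>_wt 0) (\<lambda>w. block_op \<alpha> (\<phi> w))"
  proof (rule trace_on_transport[OF B lin_on_U[OF \<alpha>(1)] bij lin(1) maps(1)])
    fix w assume w: "w \<in> \<Omega>_wt 0"
    then have "U (h \<alpha> - \<alpha>) (\<phi> w) \<in> \<Omega>" using maps(2) weight_vacuum by blast
    then show "\<phi> (U \<alpha> w) = U \<alpha> (block_op \<alpha> (\<phi> w))"
      by (simp add: \<phi>_U_block[OF \<alpha>(1) w] block_op_def U_scale[OF \<alpha>(1)])
  qed
  show "trace_on scW (\<Omega>_wt (\<pi> \<alpha>)) \<phi>
      = twist \<alpha> * trace_on scW (\<Omega>_wt 0) (\<lambda>w. U (h \<alpha> - \<alpha>) (\<phi> w))"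
    unfolding 1 block_op_def by (rule trace_on_scale[OF B lin(2) maps(2)])
qed

text \<open>For a weight \<open>\<beta>\<close> of the sum, the zero mode of \<open>\<beta> - \<gamma>\<close> minus its eigenvalue on
  \<open>\<Omega>_wt \<gamma>\<close> kills the \<open>\<gamma>\<close> component and multiplies the \<open>\<beta>\<close> component by
  \<open>\<bar>\<beta> - \<gamma>\<bar>\<^sup>2\<close>.\<close>

lemma weight_spaces_independent:
  assumes "finite I" "\<And>\<beta>. \<beta> \<in> I \<Longrightarrow> g \<beta> = \<beta>" "\<And>\<beta>. \<beta> \<in> I \<Longrightarrow> w \<beta> \<in> \<Omega>_wt \<beta>"
    "(\<Sum>\<beta>\<in>I. w \<beta>) = 0"
  shows "\<forall>\<beta>\<in>I. w \<beta> = 0"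
  using assms
proof (induction I arbitrary: w rule: finite_induct)
  case (insert \<gamma> I)
  have "w \<beta> = 0" if \<beta>: "\<beta> \<in> I" for \<beta>
  proof -
    define v where "v = cvec (\<beta> - \<gamma>)"
    have "g (\<beta> - \<gamma>) = \<beta> - \<gamma>"
      using insert.prems(1) \<beta> by (simp add: linear_diff[OF linear_g])
    then have v: "cmap g v = v" unfolding v_def using linear_g by (rule cmap_cvec_fixed)
    let ?e = "\<lambda>\<delta>. of_real ((\<beta> - \<gamma>) \<bullet> \<delta>) :: complex"
    have Yv: "Y (cur v) 0 (w \<delta>) = scW (?e \<delta>) (w \<delta>)" if "\<delta> \<in> insert \<gamma> I" for \<delta>
      using insert.prems(2)[OF that] v by (simp add: weight_space_def v_def cform_cvec_real)
    have sumY: "Y (cur v) 0 (\<Sum>\<delta>\<in>J. w \<delta>) = (\<Sum>\<delta>\<in>J. Y (cur v) 0 (w \<delta>))" if "finite J" for J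
      using that by (induction J rule: finite_induct) (simp_all add: Y_zero Y_add)
    have "(\<Sum>\<delta>\<in>insert \<gamma> I. scW (?e \<delta>) (w \<delta>)) = 0"
      using sumY[of "insert \<gamma> I"] insert.hyps(1) Yv insert.prems(3) by (simp add: Y_zero)
    moreover have "(\<Sum>\<delta>\<in>insert \<gamma> I. scW (?e \<gamma>) (w \<delta>)) = 0"
      using insert.prems(3) scale_sum_right[of "?e \<gamma>" w "insert \<gamma> I"] by simp
    ultimately have "(\<Sum>\<delta>\<in>insert \<gamma> I. scW (?e \<delta>) (w \<delta>) - scW (?e \<gamma>) (w \<delta>)) = 0"
      by (simp only: sum_subtractf diff_self)
    then have "(\<Sum>\<delta>\<in>I. scW (?e \<delta> - ?e \<gamma>) (w \<delta>)) = 0"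
      using insert.hyps by (simp add: scale_left_diff_distrib)
    moreover have "scW (?e \<delta> - ?e \<gamma>) (w \<delta>) \<in> \<Omega>_wt \<delta>" if "\<delta> \<in> I" for \<delta>
      using insert.prems(2) that by (intro subspace_scale weight_subspace) auto
    ultimately have "\<forall>\<delta>\<in>I. scW (?e \<delta> - ?e \<gamma>) (w \<delta>) = 0"
      by (intro insert.IH[of "\<lambda>\<delta>. scW (?e \<delta> - ?e \<gamma>) (w \<delta>)"] insert.prems(1) insertI2)
    then have "scW (?e \<beta> - ?e \<gamma>) (w \<beta>) = 0" using \<beta> by (rule bspec)
    moreover have "?e \<beta> - ?e \<gamma> \<noteq> 0"
    proof -
      have "?e \<beta> - ?e \<gamma> = of_real ((\<beta> - \<gamma>) \<bullet> (\<beta> - \<gamma>))" by (simp add: inner_diff_right)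
      moreover have "\<beta> \<noteq> \<gamma>" using \<beta> insert.hyps(2) by blast
      ultimately show ?thesis by (simp del: of_real_diff)
    qed
    ultimately show ?thesis by simp
  qed
  then show ?case using insert.prems(3) insert.hyps by simp
qed simp

lemma \<eta>_norm_mult: "\<alpha> \<in> L \<Longrightarrow> \<beta> \<in> L \<Longrightarrow> norm (\<eta> (\<alpha> + \<beta>)) = norm (\<eta> \<alpha>) * norm (\<eta> \<beta>)"
  using arg_cong[OF \<eta>_mult[of \<alpha> \<beta>], of norm] by (simp add: norm_mult norm_cocycle h.g_lattice)

text \<open>The map \<open>block_op\<close> is multiplicative up to a phase: the factors \<open>B\<close>, which grow like
  the exponential of a quadratic form, cancel because \<open>\<bar>B\<bar>\<close> is symmetric, bimultiplicative and
  \<open>h\<close>-invariant.\<close>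

lemma block_op_mult:
  assumes \<alpha>: "\<alpha> \<in> L" and \<beta>: "\<beta> \<in> L"
  obtains k where "norm k = 1"
    "\<And>w. w \<in> \<Omega> \<Longrightarrow> block_op (\<alpha> + \<beta>) w = scW k (block_op \<alpha> (block_op \<beta> w))"
proof -
  let ?a = "h \<alpha> - \<alpha>" and ?b = "h \<beta> - \<beta>"
  let ?e = "\<epsilon> ?a ?b * inverse (bfactor \<xi> g ?a ?b)"
  note aL = h_diff_lattice[OF \<alpha>] and bL = h_diff_lattice[OF \<beta>]
  have \<alpha>\<beta>: "\<alpha> + \<beta> \<in> L" using L_subgroup assms by (rule add_subgroup_add)
  have ab: "h (\<alpha> + \<beta>) - (\<alpha> + \<beta>) = ?a + ?b" by (simp add: linear_add[OF h.linear_g])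
  \<comment> \<open>By the product rule both sides are multiples of \<open>U (?a + ?b) w\<close>;
    \<open>k\<close> is the ratio of the scalars.\<close>
  define k where "k = twist (\<alpha> + \<beta>) / (twist \<alpha> * twist \<beta> * ?e)"
  have e0: "?e \<noteq> 0" using norm_cocycle[OF aL bL] bfactor_nonzero by auto
  show thesis
  proof (rule that)
    fix w assume w: "w \<in> \<Omega>"
    have Uw: "U ?b w \<in> \<Omega>" using bij_betwE[OF U_bij[OF bL]] w by blast
    have "block_op \<alpha> (block_op \<beta> w) = scW (twist \<alpha> * twist \<beta> * ?e) (U (?a + ?b) w)"
      unfolding block_op_def U_scale[OF aL Uw] U_mult[OF aL bL w] by (simp add: mult.assoc)
    then show "block_op (\<alpha> + \<beta>) w = scW k (block_op \<alpha> (block_op \<beta> w))"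
      unfolding block_op_def[of "\<alpha> + \<beta>"] ab k_def
      using e0 twist_nonzero[OF \<alpha>] twist_nonzero[OF \<beta>] by simp
  next
    let ?B = "\<lambda>x y. norm (bfactor \<xi> g x y)"
    have sym: "?B x y = ?B y x" if "x \<in> L" "y \<in> L" for x y
      using norm_bfactor_commute that by simp
    have pos: "?B x y > 0" for x y using bfactor_nonzero by simp
    have addl: "?B (x + y) z = ?B x z * ?B y z" if "x \<in> L" "y \<in> L" "z \<in> L" for x y z
      using bfactor_add_left that by (simp add: norm_mult)
    note addr = norm_bfactor_add_right
    note hL = h.g_lattice[OF \<alpha>] h.g_lattice[OF \<beta>]
    have tw: "norm (twist x) = ?B x (h x - x) / norm (\<eta> x)" if "x \<in> L" for x
      using norm_cocycle[OF that h_diff_lattice[OF that]]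
      by (simp add: twist_def norm_mult norm_inverse divide_inverse mult_ac)
    have 1: "?B (\<alpha> + \<beta>) (?a + ?b) = (?B \<alpha> ?a * ?B \<alpha> ?b) * (?B \<beta> ?a * ?B \<beta> ?b)"
      by (simp only: addl addr \<alpha> \<beta> aL bL \<alpha>\<beta> add_subgroup_add[OF L_subgroup]) (simp only: mult_ac)
    have 2: "?B (h \<alpha>) (h \<beta>) = ?B \<alpha> \<beta>" using bfactor_invariant[OF h.orth commute] by simp
    have 3: "?B (h \<alpha>) ?b = ?B ?a ?b * ?B \<alpha> ?b" using addl[OF aL \<alpha> bL] by simp
    have 4: "?B (h \<alpha>) (h \<beta>) = ?B (h \<alpha>) ?b * ?B (h \<alpha>) \<beta>" using addr[OF bL \<beta> hL(1)] by simp
    have 5: "?B \<beta> (h \<alpha>) = ?B \<beta> ?a * ?B \<beta> \<alpha>" using addr[OF aL \<alpha> \<beta>] by simp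
    \<comment> \<open>Expanding the \<open>h\<close>-invariance of \<open>?B\<close> along
      \<open>h \<alpha> = \<alpha> + ?a\<close> and \<open>h \<beta> = \<beta> + ?b\<close> shows
      that these three factors multiply to 1; they are exactly what survives in
      \<open>norm k\<close>.\<close>
    have "?B \<alpha> \<beta> = ?B ?a ?b * ?B \<alpha> ?b * (?B \<beta> ?a * ?B \<alpha> \<beta>)"
      using 2 3 4 5 sym[OF hL(1) \<beta>] sym[OF \<beta> \<alpha>] by simp
    then have 6: "?B ?a ?b * ?B \<alpha> ?b * ?B \<beta> ?a = 1"
      using pos[of \<alpha> \<beta>] by simp
    have "norm k = ?B (\<alpha> + \<beta>) (?a + ?b) / norm (\<eta> (\<alpha> + \<beta>)) /
        (?B \<alpha> ?a / norm (\<eta> \<alpha>) * (?B \<beta> ?b / norm (\<eta> \<beta>)) / ?B ?a ?b)"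
      using norm_cocycle[OF aL bL]
      by (simp add: k_def norm_divide norm_mult norm_inverse tw[OF \<alpha>] tw[OF \<beta>] tw[OF \<alpha>\<beta>] ab divide_inverse)
    also have "\<dots> = ?B ?a ?b * ?B \<alpha> ?b * ?B \<beta> ?a"
      unfolding 1 \<eta>_norm_mult[OF \<alpha> \<beta>]
      using pos \<eta>_nonzero[OF \<alpha>] \<eta>_nonzero[OF \<beta>] by (simp add: field_simps bfactor_nonzero)
    finally show "norm k = 1" using 6 by simp
  qed
qed

section \<open>Weights fixed by \<open>h\<close> and the growth of their traces\<close>

abbreviation fixed_weights :: "(real ^ 'n) set" where
  "fixed_weights \<equiv> {\<beta>\<in>\<pi> ` L. h \<beta> = \<beta>}"

lemma fixed_weights_subgroup: "add_subgroup fixed_weights"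
  unfolding add_subgroup_def
proof (intro conjI ballI)
  show "0 \<in> fixed_weights" using \<pi>_zero_mem linear_0[OF h.linear_g] by blast
  fix x y assume "x \<in> fixed_weights" "y \<in> fixed_weights"
  then obtain \<alpha> \<beta> where *: "\<alpha> \<in> L" "\<beta> \<in> L" "x = \<pi> \<alpha>" "y = \<pi> \<beta>" "h x = x" "h y = y" by blast
  then have "x - y = \<pi> (\<alpha> - \<beta>)" "\<alpha> - \<beta> \<in> L"
    by (simp_all add: linear_diff[OF linear_fix_proj] add_subgroup_diff[OF L_subgroup])
  moreover have "h (x - y) = x - y" using * by (simp add: linear_diff[OF h.linear_g])
  ultimately show "x - y \<in> fixed_weights" by blast
qed

text \<open>\<open>\<Lambda>\<close> is a complement of the kernel of \<open>\<pi>\<close> on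
  \<open>L\<close>, so \<open>\<pi>\<close> is injective on it with full image. Since
  \<open>\<pi>\<close> commutes with \<open>h\<close>, the condition defining the second set says
  that \<open>h\<close> fixes \<open>\<pi> \<alpha>\<close>.\<close>

lemma complement_bij:
  assumes \<Lambda>: "complement_sublattice L g \<Lambda>"
  shows "bij_betw \<pi> \<Lambda> (\<pi> ` L)"
    and "bij_betw \<pi> {\<alpha>\<in>\<Lambda>. \<pi> \<alpha> = \<pi> (h \<alpha>)} fixed_weights"
proof -
  have \<Lambda>L: "\<Lambda> \<subseteq> L" and diff: "\<And>x y. x \<in> \<Lambda> \<Longrightarrow> y \<in> \<Lambda> \<Longrightarrow> x - y \<in> \<Lambda>"
    and decomp: "L = {x + y | x y. x \<in> \<Lambda> \<and> y \<in> fixed_perp L g}"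
    and triv: "\<Lambda> \<inter> fixed_perp L g = {0}"
    using \<Lambda> unfolding complement_sublattice_def by blast+
  have inj: "inj_on \<pi> \<Lambda>"
  proof (rule inj_onI)
    fix x y assume xy: "x \<in> \<Lambda>" "y \<in> \<Lambda>" "\<pi> x = \<pi> y"
    then have "x - y \<in> \<Lambda> \<inter> fixed_perp L g"
      using diff[OF xy(1,2)] \<Lambda>L by (auto simp: fixed_perp_def linear_diff[OF linear_fix_proj])
    then show "x = y" using triv by auto
  qed
  have surj: "\<exists>\<alpha>\<in>\<Lambda>. \<beta> = \<pi> \<alpha>" if \<beta>: "\<beta> \<in> \<pi> ` L" for \<beta>
  proof -
    obtain z where z: "z \<in> L" "\<beta> = \<pi> z" using \<beta> by blast
    then obtain x y where xy: "z = x + y" "x \<in> \<Lambda>" "y \<in> fixed_perp L g" using decomp by blast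
    then have "\<beta> = \<pi> x"
      using z(2) by (simp add: fixed_perp_def linear_add[OF linear_fix_proj])
    then show ?thesis using xy(2) by blast
  qed
  show "bij_betw \<pi> \<Lambda> (\<pi> ` L)"
    unfolding bij_betw_def using inj surj \<Lambda>L by blast
  have "\<pi> ` {\<alpha>\<in>\<Lambda>. \<pi> \<alpha> = \<pi> (h \<alpha>)} = fixed_weights"
  proof (intro equalityI subsetI)
    fix \<beta> assume "\<beta> \<in> \<pi> ` {\<alpha>\<in>\<Lambda>. \<pi> \<alpha> = \<pi> (h \<alpha>)}"
    then obtain \<alpha> where "\<alpha> \<in> \<Lambda>" "\<pi> \<alpha> = \<pi> (h \<alpha>)" "\<beta> = \<pi> \<alpha>" by blast
    then show "\<beta> \<in> fixed_weights" using \<Lambda>L \<pi>_h[of \<alpha>] by auto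
  next
    fix \<beta> assume \<beta>: "\<beta> \<in> fixed_weights"
    then obtain \<alpha> where \<alpha>: "\<alpha> \<in> \<Lambda>" "\<beta> = \<pi> \<alpha>" using surj by blast
    then have "\<pi> \<alpha> = \<pi> (h \<alpha>)" using \<beta> by (simp add: \<pi>_h)
    then show "\<beta> \<in> \<pi> ` {\<alpha>\<in>\<Lambda>. \<pi> \<alpha> = \<pi> (h \<alpha>)}" using \<alpha> by blast
  qed
  then show "bij_betw \<pi> {\<alpha>\<in>\<Lambda>. \<pi> \<alpha> = \<pi> (h \<alpha>)} fixed_weights"
    using inj_on_subset[OF inj] by (simp add: bij_betw_def)
qed

text \<open>Lifting fixed weights to \<open>\<Lambda>\<close> is additive, so the norm of
  \<open>block_op\<close> becomes a submultiplicative function on the discrete group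
  \<open>fixed_weights\<close>. It bounds the trace up to the constant factor
  \<open>op_norm B \<phi>\<close>.\<close>

lemma trace_weight_growth:
  assumes \<Lambda>: "complement_sublattice L g \<Lambda>"
  obtains C c where "\<And>\<beta>. \<beta> \<in> fixed_weights \<Longrightarrow> norm (trace_on scW (\<Omega>_wt \<beta>) \<phi>) \<le> C * exp (c * norm \<beta>)"
proof -
  obtain B where B: "independent B" "finite B" "span B = \<Omega>_wt 0" by (rule weight_zero_basis)
  let ?\<Lambda>h = "{\<alpha>\<in>\<Lambda>. \<pi> \<alpha> = \<pi> (h \<alpha>)}"
  \<comment> \<open>The inverse of \<open>\<pi>\<close> on these lifts; its additivity will follow
    from injectivity of \<open>\<pi>\<close> on all of \<open>\<Lambda>\<close>.\<close>
  define s where "s = the_inv_into ?\<Lambda>h \<pi>"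
  note bij = complement_bij(2)[OF \<Lambda>]
  note inj = bij_betw_imp_inj_on[OF complement_bij(1)[OF \<Lambda>]]
  have \<Lambda>L: "\<Lambda> \<subseteq> L" and \<Lambda>add: "add_subgroup \<Lambda>"
    using \<Lambda> unfolding complement_sublattice_def add_subgroup_def by blast+
  have s: "s \<beta> \<in> \<Lambda>" "\<pi> (s \<beta>) = \<beta>" "\<pi> (h (s \<beta>)) = \<pi> (s \<beta>)" "s \<beta> \<in> L" if "\<beta> \<in> fixed_weights" for \<beta>
  proof -
    have "s \<beta> \<in> ?\<Lambda>h"
      unfolding s_def by (rule bij_betw_apply[OF bij_betw_the_inv_into[OF bij] that])
    moreover have "\<pi> (s \<beta>) = \<beta>"
      unfolding s_def by (rule f_the_inv_into_f_bij_betw[OF bij]) (rule that)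
    ultimately show "s \<beta> \<in> \<Lambda>" "\<pi> (s \<beta>) = \<beta>" "\<pi> (h (s \<beta>)) = \<pi> (s \<beta>)" "s \<beta> \<in> L" using \<Lambda>L by auto
  qed
  have s_add: "s (\<beta> + \<gamma>) = s \<beta> + s \<gamma>" if "\<beta> \<in> fixed_weights" "\<gamma> \<in> fixed_weights" for \<beta> \<gamma>
  proof (rule inj_onD[OF inj])
    have \<beta>\<gamma>: "\<beta> + \<gamma> \<in> fixed_weights" by (rule add_subgroup_add[OF fixed_weights_subgroup that])
    show "s (\<beta> + \<gamma>) \<in> \<Lambda>" by (rule s(1)[OF \<beta>\<gamma>])
    show "s \<beta> + s \<gamma> \<in> \<Lambda>" by (intro add_subgroup_add[OF \<Lambda>add] s(1) that)
    show "\<pi> (s (\<beta> + \<gamma>)) = \<pi> (s \<beta> + s \<gamma>)"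
      by (simp only: linear_add[OF linear_fix_proj] s(2) that \<beta>\<gamma>)
  qed
  define N where "N \<beta> = op_norm B (block_op (s \<beta>))" for \<beta>
  have submult: "N (\<beta> + \<gamma>) \<le> N \<beta> * N \<gamma>" if \<beta>: "\<beta> \<in> fixed_weights" and \<gamma>: "\<gamma> \<in> fixed_weights" for \<beta> \<gamma>
  proof -
    note op\<beta> = block_op_weight_zero[OF s(4,3)[OF \<beta>]] and op\<gamma> = block_op_weight_zero[OF s(4,3)[OF \<gamma>]]
    obtain k where k: "norm k = 1"
      "\<And>w. w \<in> \<Omega> \<Longrightarrow> block_op (s \<beta> + s \<gamma>) w = scW k (block_op (s \<beta>) (block_op (s \<gamma>) w))"
      by (rule block_op_mult[OF s(4)[OF \<beta>] s(4)[OF \<gamma>]], rule that)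
    have maps: "(\<lambda>w. block_op (s \<beta>) (block_op (s \<gamma>) w)) ` \<Omega>_wt 0 \<subseteq> \<Omega>_wt 0"
      using op\<beta>(3) op\<gamma>(3) by blast
    have B\<Omega>: "b \<in> \<Omega>" if "b \<in> B" for b using B(3) span_base[OF that] weight_vacuum by blast
    have "N (\<beta> + \<gamma>) = op_norm B (\<lambda>w. scW k (block_op (s \<beta>) (block_op (s \<gamma>) w)))"
      unfolding N_def s_add[OF \<beta> \<gamma>] op_norm_def using k(2) B\<Omega> by (intro sum.cong refl) simp
    also have "\<dots> = op_norm B (\<lambda>w. block_op (s \<beta>) (block_op (s \<gamma>) w))"
      using op_norm_scale[OF B(1,3) maps] k(1) by simp
    also have "\<dots> \<le> N \<beta> * N \<gamma>"
      unfolding N_def by (rule op_norm_compose_le[OF B op\<beta>(2,3) op\<gamma>(3)])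
    finally show ?thesis .
  qed
  have discrete: "finite {\<beta>\<in>fixed_weights. norm \<beta> \<le> R}" for R
    by (rule finite_subset[OF _ finite_fix_proj_ball[of R]]) blast
  obtain C c where C: "\<And>\<beta>. \<beta> \<in> fixed_weights \<Longrightarrow> N \<beta> \<le> C * exp (c * norm \<beta>)"
    using submultiplicative_growth[OF fixed_weights_subgroup discrete, of N] submult op_norm_nonneg
    unfolding N_def by blast
  show thesis
  proof (rule that)
    fix \<beta> assume \<beta>: "\<beta> \<in> fixed_weights"
    note op = block_op_weight_zero[OF s(4,3)[OF \<beta>]]
    have \<phi>0: "\<phi> ` \<Omega>_wt 0 \<subseteq> \<Omega>_wt 0" using \<phi>_weight_zero by blast
    have lin: "lin_on (\<Omega>_wt 0) (\<lambda>w. block_op (s \<beta>) (\<phi> w))"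
      using op(2) \<phi>_weight_zero by (simp add: lin_on_def \<phi>_add \<phi>_scale)
    have maps: "(\<lambda>w. block_op (s \<beta>) (\<phi> w)) ` \<Omega>_wt 0 \<subseteq> \<Omega>_wt 0" using op(3) \<phi>0 by blast
    have "trace_on scW (\<Omega>_wt \<beta>) \<phi> = trace_on scW (\<Omega>_wt 0) (\<lambda>w. block_op (s \<beta>) (\<phi> w))"
      using trace_weight(1)[OF s(4,3)[OF \<beta>]] s(2)[OF \<beta>] by simp
    then have "norm (trace_on scW (\<Omega>_wt \<beta>) \<phi>) \<le> op_norm B (\<lambda>w. block_op (s \<beta>) (\<phi> w))"
      using norm_trace_on_le[OF B lin maps] by simp
    also have "\<dots> \<le> N \<beta> * op_norm B \<phi>"
      unfolding N_def by (rule op_norm_compose_le[OF B op(2,3) \<phi>0])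
    also have "\<dots> \<le> (C * exp (c * norm \<beta>)) * op_norm B \<phi>"
      by (intro mult_right_mono C \<beta> op_norm_nonneg)
    finally show "norm (trace_on scW (\<Omega>_wt \<beta>) \<phi>) \<le> (C * op_norm B \<phi>) * exp (c * norm \<beta>)"
      by (simp only: mult_ac)
  qed
qed

section \<open>Decomposition by degree and convergence of the graded trace\<close>

lemma vacuum_part_weights:
  assumes \<Lambda>: "complement_sublattice L g \<Lambda>"
  shows "vacuum_part cur scW Y U \<Lambda> g d = span (\<Union>\<beta>\<in>{\<beta>\<in>\<pi> ` L. (norm \<beta>)\<^sup>2 / 2 = d}. \<Omega>_wt \<beta>)"
proof -
  have \<Lambda>L: "\<alpha> \<in> L" if "\<alpha> \<in> \<Lambda>" for \<alpha>
    using \<Lambda> that unfolding complement_sublattice_def by blast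
  \<comment> \<open>Passing to weight spaces removes \<open>U\<close> and \<open>\<Lambda>\<close>
    from the description of the degree part.\<close>
  have *: "U \<alpha> ` \<Omega>_wt 0 = \<Omega>_wt (\<pi> \<alpha>)" if "\<alpha> \<in> \<Lambda>" for \<alpha>
    using U_weight[OF \<pi>_zero_mem \<Lambda>L[OF that]] by simp
  have "\<pi> ` L = \<pi> ` \<Lambda>" using bij_betw_imp_surj_on[OF complement_bij(1)[OF \<Lambda>]] by simp
  then have "{\<beta>\<in>\<pi> ` L. (norm \<beta>)\<^sup>2 / 2 = d} = \<pi> ` {\<alpha>\<in>\<Lambda>. vdegree g \<alpha> = d}"
    by (auto simp: vdegree_def)
  then show ?thesis unfolding vacuum_part_def using * by simp
qed

lemma finite_weights_degree: "finite {\<beta>\<in>\<pi> ` L. (norm \<beta>)\<^sup>2 / 2 = d}"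
proof (rule finite_subset)
  show "{\<beta>\<in>\<pi> ` L. (norm \<beta>)\<^sup>2 / 2 = d} \<subseteq> {\<beta>\<in>\<pi> ` L. norm \<beta> \<le> sqrt (2 * d)}"
    by (auto intro!: real_le_rsqrt)
  show "finite {\<beta>\<in>\<pi> ` L. norm \<beta> \<le> sqrt (2 * d)}" by (rule finite_fix_proj_ball)
qed

text \<open>\<open>h\<close> is an isometry commuting with \<open>\<pi>\<close>, so it permutes the
  finitely many weights of a given degree and \<open>\<phi>\<close> moves their spaces accordingly;
  only the fixed weights carry a diagonal block.\<close>

lemma trace_vacuum_part:
  assumes \<Lambda>: "complement_sublattice L g \<Lambda>"
  shows "trace_on scW (vacuum_part cur scW Y U \<Lambda> g d) \<phi>
    = (\<Sum>\<beta>\<in>{\<beta>\<in>fixed_weights. (norm \<beta>)\<^sup>2 / 2 = d}. trace_on scW (\<Omega>_wt \<beta>) \<phi>)"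
proof -
  let ?I = "{\<beta>\<in>\<pi> ` L. (norm \<beta>)\<^sup>2 / 2 = d}"
  define B where "B \<beta> = (SOME B. independent B \<and> finite B \<and> span B = \<Omega>_wt \<beta>)" for \<beta>
  have *: "independent (B \<beta>) \<and> finite (B \<beta>) \<and> span (B \<beta>) = \<Omega>_wt \<beta>" if "\<beta> \<in> ?I" for \<beta>
  proof -
    have "\<beta> \<in> \<pi> ` L" using that by simp
    then have "\<exists>B. independent B \<and> finite B \<and> span B = \<Omega>_wt \<beta>" using weight_basis by blast
    then show ?thesis unfolding B_def by (rule someI_ex)
  qed
  then have B: "\<And>\<beta>. \<beta> \<in> ?I \<Longrightarrow> independent (B \<beta>)" "\<And>\<beta>. \<beta> \<in> ?I \<Longrightarrow> finite (B \<beta>)"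
    "\<And>\<beta>. \<beta> \<in> ?I \<Longrightarrow> span (B \<beta>) = \<Omega>_wt \<beta>"
    by simp_all
  have hI: "h \<beta> \<in> ?I" if \<beta>: "\<beta> \<in> ?I" for \<beta>
  proof -
    obtain \<alpha> where "\<alpha> \<in> L" "\<beta> = \<pi> \<alpha>" using \<beta> by blast
    then have "h \<beta> \<in> \<pi> ` L" using \<pi>_h[of \<alpha>] h.g_lattice by (metis imageI)
    then show ?thesis using \<beta> by simp
  qed
  have \<phi>I: "\<phi> ` \<Omega>_wt \<beta> \<subseteq> \<Omega>_wt (h \<beta>)" for \<beta> using \<phi>_weight by blast
  have "trace_on scW (span (\<Union>\<beta>\<in>?I. \<Omega>_wt \<beta>)) \<phi> = (\<Sum>\<beta>\<in>{\<beta>\<in>?I. h \<beta> = \<beta>}. trace_on scW (\<Omega>_wt \<beta>) \<phi>)"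
  proof (rule trace_on_permuted_blocks[where I = ?I and B = B and \<sigma> = h])
    show "finite ?I" by (rule finite_weights_degree)
    fix w assume w: "\<And>i. i \<in> ?I \<Longrightarrow> w i \<in> \<Omega>_wt i" "(\<Sum>i\<in>?I. w i) = 0"
    show "\<forall>i\<in>?I. w i = 0"
      by (rule weight_spaces_independent[OF finite_weights_degree _ w]) (blast intro: \<pi>_image_fixed)+
  qed (rule B lin_on_\<phi> hI \<phi>I; assumption)+
  moreover have "{\<beta>\<in>?I. h \<beta> = \<beta>} = {\<beta>\<in>fixed_weights. (norm \<beta>)\<^sup>2 / 2 = d}" by blast
  ultimately show ?thesis by (simp only: vacuum_part_weights[OF \<Lambda>])
qed

lemma norm_qpow: "norm (qpow \<tau> d) = exp (- (2 * pi * Im \<tau>) * d)"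
  by (simp add: qpow_def norm_exp_eq_Re)

lemma weight_trace_summable:
  assumes \<Lambda>: "complement_sublattice L g \<Lambda>" and \<tau>: "Im \<tau> > 0"
  shows "(\<lambda>\<beta>. qpow \<tau> ((norm \<beta>)\<^sup>2 / 2) * trace_on scW (\<Omega>_wt \<beta>) \<phi>) summable_on fixed_weights"
    (is "?F summable_on _")
proof -
  obtain C c where C: "\<And>\<beta>. \<beta> \<in> fixed_weights \<Longrightarrow> norm (trace_on scW (\<Omega>_wt \<beta>) \<phi>) \<le> C * exp (c * norm \<beta>)"
    using trace_weight_growth[OF \<Lambda>] by blast
  \<comment> \<open>The decay rate of the absolute value of \<open>q\<close> to the power
    \<open>(norm \<beta>)\<^sup>2 / 2\<close>: the 2 of \<open>2 * pi\<close> cancels against the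
    denominator.\<close>
  define a where "a = pi * Im \<tau>"
  have "a > 0" using \<tau> by (simp add: a_def)
  then have "(\<lambda>\<beta>. exp (- a * (norm \<beta>)\<^sup>2 + c * norm \<beta>)) summable_on fixed_weights"
    by (rule summable_on_subset_banach[OF fix_proj_gaussian_summable]) blast
  then have "(\<lambda>\<beta>. C * exp (- a * (norm \<beta>)\<^sup>2 + c * norm \<beta>)) summable_on fixed_weights"
    by (rule summable_on_cmult_right)
  then have "(\<lambda>\<beta>. norm (?F \<beta>)) summable_on fixed_weights"
  proof (rule summable_on_comparison_test)
    fix \<beta> assume \<beta>: "\<beta> \<in> fixed_weights"
    have "norm (qpow \<tau> ((norm \<beta>)\<^sup>2 / 2)) = exp (- a * (norm \<beta>)\<^sup>2)"
      by (simp add: norm_qpow a_def)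
    then have "norm (?F \<beta>) \<le> exp (- a * (norm \<beta>)\<^sup>2) * (C * exp (c * norm \<beta>))"
      using mult_left_mono[OF C[OF \<beta>], of "exp (- a * (norm \<beta>)\<^sup>2)"] by (simp only: norm_mult exp_ge_zero)
    then show "norm (?F \<beta>) \<le> C * exp (- a * (norm \<beta>)\<^sup>2 + c * norm \<beta>)"
      unfolding exp_add by (simp only: mult_ac)
  qed simp
  then show ?thesis by (rule abs_summable_summable)
qed

text \<open>The traces over the fixed weights form one summable family. Grouping it by degree gives
  \<open>T_lattice\<close>; reindexing it by lifts in \<open>\<Lambda>\<close> gives the
  formula.\<close>

lemma graded_trace:
  assumes \<Lambda>: "complement_sublattice L g \<Lambda>" and \<tau>: "Im \<tau> > 0"
  shows "T_term cur scW Y U \<Lambda> g \<phi> \<tau> summable_on vdegree g ` \<Lambda>"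
    and "((\<lambda>\<alpha>. qpow \<tau> ((norm (\<pi> \<alpha>))\<^sup>2 / 2) * inverse (\<eta> \<alpha>) *
           \<epsilon> \<alpha> (h \<alpha> - \<alpha>) * bfactor \<xi> g \<alpha> (h \<alpha> - \<alpha>) *
           trace_on scW (\<Omega>_wt 0) (\<lambda>w. U (h \<alpha> - \<alpha>) (\<phi> w)))
      has_sum T_lattice cur scW Y U \<Lambda> g \<phi> \<tau>) {\<alpha>\<in>\<Lambda>. \<pi> \<alpha> = \<pi> (h \<alpha>)}"
proof -
  let ?D = "vdegree g ` \<Lambda>"
  define F where "F \<beta> = qpow \<tau> ((norm \<beta>)\<^sup>2 / 2) * trace_on scW (\<Omega>_wt \<beta>) \<phi>" for \<beta>
  define G where "G d = {\<beta>\<in>fixed_weights. (norm \<beta>)\<^sup>2 / 2 = d}" for d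
  have F: "F summable_on fixed_weights"
    unfolding F_def by (rule weight_trace_summable[OF \<Lambda> \<tau>])
  have \<Lambda>L: "\<alpha> \<in> L" if "\<alpha> \<in> \<Lambda>" for \<alpha>
    using \<Lambda> that unfolding complement_sublattice_def by blast
  have "(norm \<beta>)\<^sup>2 / 2 \<in> ?D" if "\<beta> \<in> fixed_weights" for \<beta>
  proof -
    have "\<beta> \<in> \<pi> ` \<Lambda>"
      using that unfolding bij_betw_imp_surj_on[OF complement_bij(1)[OF \<Lambda>]] by simp
    then show ?thesis by (auto simp: vdegree_def)
  qed
  \<comment> \<open>Every fixed weight has exactly one degree, so the fibres \<open>G d\<close>
    partition \<open>fixed_weights\<close>.\<close>
  then have bij: "bij_betw snd (Sigma ?D G) fixed_weights"
    by (intro bij_betwI[where g = "\<lambda>\<beta>. ((norm \<beta>)\<^sup>2 / 2, \<beta>)"]) (auto simp: G_def)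
  have FS: "(\<lambda>(d, \<beta>). F \<beta>) summable_on Sigma ?D G"
    using F summable_on_reindex_bij_betw[OF bij, of F] by (simp add: case_prod_unfold)
  \<comment> \<open>Each degree term is the finite sum over its fibre; a degree without fixed
    weights contributes 0.\<close>
  have T: "T_term cur scW Y U \<Lambda> g \<phi> \<tau> d = infsum F (G d)" for d
  proof -
    have "finite (G d)" unfolding G_def by (rule finite_subset[OF _ finite_weights_degree[of d]]) blast
    then have "infsum F (G d) = (\<Sum>\<beta>\<in>G d. F \<beta>)" by simp
    also have "\<dots> = (\<Sum>\<beta>\<in>G d. qpow \<tau> d * trace_on scW (\<Omega>_wt \<beta>) \<phi>)"
      by (intro sum.cong refl) (auto simp: F_def G_def)
    also have "\<dots> = T_term cur scW Y U \<Lambda> g \<phi> \<tau> d"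
      by (simp only: T_term_def trace_vacuum_part[OF \<Lambda>] G_def sum_distrib_left)
    finally show ?thesis ..
  qed
  show "T_term cur scW Y U \<Lambda> g \<phi> \<tau> summable_on ?D"
    unfolding T[abs_def] by (rule summable_on_Sigma_banach[OF FS])
  have "T_lattice cur scW Y U \<Lambda> g \<phi> \<tau> = infsum F fixed_weights"
    unfolding T_lattice_def T infsum_Sigma'_banach[OF FS]
    using infsum_reindex_bij_betw[OF bij, of F] by (simp add: case_prod_unfold)
  then have "(F has_sum T_lattice cur scW Y U \<Lambda> g \<phi> \<tau>) fixed_weights"
    using has_sum_infsum[OF F] by simp
  then have sum: "((\<lambda>\<alpha>. F (\<pi> \<alpha>)) has_sum T_lattice cur scW Y U \<Lambda> g \<phi> \<tau>) {\<alpha>\<in>\<Lambda>. \<pi> \<alpha> = \<pi> (h \<alpha>)}"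
    by (rule has_sum_reindex_bij_betw[OF complement_bij(2)[OF \<Lambda>], THEN iffD2])
  have eq: "F (\<pi> \<alpha>) = qpow \<tau> ((norm (\<pi> \<alpha>))\<^sup>2 / 2) * inverse (\<eta> \<alpha>) *
      \<epsilon> \<alpha> (h \<alpha> - \<alpha>) * bfactor \<xi> g \<alpha> (h \<alpha> - \<alpha>) *
      trace_on scW (\<Omega>_wt 0) (\<lambda>w. U (h \<alpha> - \<alpha>) (\<phi> w))" if "\<alpha> \<in> {\<alpha>\<in>\<Lambda>. \<pi> \<alpha> = \<pi> (h \<alpha>)}" for \<alpha>
  proof -
    have "\<alpha> \<in> L" "\<pi> (h \<alpha>) = \<pi> \<alpha>" using that \<Lambda>L by auto
    from trace_weight(2)[OF this] show ?thesis by (simp only: F_def twist_def mult.assoc)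
  qed
  show "((\<lambda>\<alpha>. qpow \<tau> ((norm (\<pi> \<alpha>))\<^sup>2 / 2) * inverse (\<eta> \<alpha>) *
           \<epsilon> \<alpha> (h \<alpha> - \<alpha>) * bfactor \<xi> g \<alpha> (h \<alpha> - \<alpha>) *
           trace_on scW (\<Omega>_wt 0) (\<lambda>w. U (h \<alpha> - \<alpha>) (\<phi> w)))
      has_sum T_lattice cur scW Y U \<Lambda> g \<phi> \<tau>) {\<alpha>\<in>\<Lambda>. \<pi> \<alpha> = \<pi> (h \<alpha>)}"
    using sum by (rule has_sum_cong[THEN iffD1, rotated]) (rule eq)
qed

end

section \<open>The twining character\<close>

text \<open>\<open>T_lattice\<close> is an \<open>infsum\<close>, which is 0 for a family that is
  not summable. The first conjunct excludes this case, and \<open>has_sum\<close> asserts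
  convergence of the right-hand side together with its value.\<close>

theorem theorem6p3:
  fixes L \<Lambda> :: "(real ^ 'n) set"
    and g h :: "real ^ 'n \<Rightarrow> real ^ 'n"
    and \<epsilon> :: "real ^ 'n \<Rightarrow> real ^ 'n \<Rightarrow> complex"
    and \<eta>g \<eta>h :: "real ^ 'n \<Rightarrow> complex"
    and sc :: "complex \<Rightarrow> 'v \<Rightarrow> 'v::ab_group_add"
    and vac :: 'v
    and mode :: "'v \<Rightarrow> int \<Rightarrow> 'v \<Rightarrow> 'v"
    and cur :: "complex ^ 'n \<Rightarrow> 'v"
    and ex :: "real ^ 'n \<Rightarrow> 'v"
    and ghat hhat :: "'v \<Rightarrow> 'v"
    and \<xi> \<zeta> \<tau> :: complex
    and scW :: "complex \<Rightarrow> 'w \<Rightarrow> 'w::ab_group_add"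
    and Y :: "'v \<Rightarrow> real \<Rightarrow> 'w \<Rightarrow> 'w"
    and U :: "real ^ 'n \<Rightarrow> 'w \<Rightarrow> 'w"
    and \<phi> :: "'w \<Rightarrow> 'w"
  assumes "even_unimodular_lattice L"
    and "g \<in> lattice_Aut L" and "h \<in> lattice_Aut L" and "g \<circ> h = h \<circ> g"
    and "lattice_cocycle L \<epsilon>"
    and "lattice_vertex_algebra sc vac mode L \<epsilon> cur ex"
    and "standard_lift sc vac mode L \<epsilon> cur ex g \<eta>g ghat"
    and "standard_lift sc vac mode L \<epsilon> cur ex h \<eta>h hhat"
    and "ghat \<circ> hhat = hhat \<circ> ghat"
    and "primitive_root_of_unity (fun_order g) \<xi>"
    and "primitive_root_of_unity (fun_order ghat) \<zeta>"
    and "\<zeta> ^ (fun_order ghat div fun_order g) = \<xi>"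
    and "irreducible_twisted_module sc vac mode (conformal_vector sc mode cur) ghat \<zeta> scW Y"
    and "vacuum_operators L \<epsilon> g \<xi> cur ex scW Y U"
    and "intertwines scW Y hhat \<phi>"
    and "complement_sublattice L g \<Lambda>"
    and "Im \<tau> > 0"
  shows "T_term cur scW Y U \<Lambda> g \<phi> \<tau> summable_on vdegree g ` \<Lambda> \<and>
    ((\<lambda>\<alpha>. qpow \<tau> ((norm (fix_proj g \<alpha>))\<^sup>2 / 2) * inverse (\<eta>h \<alpha>) *
           \<epsilon> \<alpha> (h \<alpha> - \<alpha>) * bfactor \<xi> g \<alpha> (h \<alpha> - \<alpha>) *
           trace_on scW (weight_space cur scW Y g 0) (\<lambda>w. U (h \<alpha> - \<alpha>) (\<phi> w)))
      has_sum T_lattice cur scW Y U \<Lambda> g \<phi> \<tau>)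
    {\<alpha>\<in>\<Lambda>. fix_proj g \<alpha> = fix_proj g (h \<alpha>)}"
proof -
  interpret Tw: irreducible_twisted_module sc vac mode "conformal_vector sc mode cur" ghat \<zeta> scW Y
    by fact
  have L: "full_lattice L" and dual: "dual_lattice L = L"
    using \<open>even_unimodular_lattice L\<close> by (auto simp: even_unimodular_lattice_def)
  \<comment> \<open>Self-duality places every vector of \<open>L\<close> in the dual lattice, which
    is integrality of the form.\<close>
  have integral: "x \<bullet> y \<in> \<int>" if "x \<in> L" "y \<in> L" for x y
    using that dual by (auto simp: dual_lattice_def)
  note lift = \<open>standard_lift sc vac mode L \<epsilon> cur ex h \<eta>h hhat\<close>[unfolded standard_lift_def]
  note \<phi> = \<open>intertwines scW Y hhat \<phi>\<close>[unfolded intertwines_def]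
  interpret twisted_vacuum L g \<xi> \<epsilon> cur ex scW Y U sc h hhat \<eta>h \<phi>
  proof (rule twisted_vacuum.intro)
    show "integral_lattice_isometry L g \<xi>"
      by unfold_locales (fact L assms | rule integral, assumption+)+
    show "vacuum_operators L \<epsilon> g \<xi> cur ex scW Y U" by fact
    show "complex_vector_space scW" by (rule complex_vector_space.intro) (rule Tw.W_vector_space)
    show "twisted_vacuum_axioms L g \<epsilon> cur ex scW Y sc h hhat \<eta>h \<phi>"
    proof (rule twisted_vacuum_axioms.intro)
      show "Vector_Spaces.linear scW scW (Y a r)" for a r by (rule Tw.W_linear_right)
      show "Y (sc c a) r w = scW c (Y a r w)" for c a r w
        by (rule module_hom.scale[OF module_hom_linearI[OF Tw.W_linear_left]])
    qed (use assms lift \<phi> in blast)+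
  qed
  show ?thesis
    using graded_trace[OF \<open>complement_sublattice L g \<Lambda>\<close> \<open>Im \<tau> > 0\<close>] by (rule conjI)
qed

end
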